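(* Let $m,d\in\mathbb{N}$ and let $\phi:[0,1]^{m}\times[0,1]\to\mathbb{R}^{d}$ be a family of rationally non-degenerate analytic curves of order $\kappa$, where $2\leq\kappa\leq\infty$. Let $\{\rho_{n}\}_{n=1}^{\infty}\subseteq\mathbb{R}$ with $\rho_{n}\to\infty$, and assume that \begin{itemize} \item if $\kappa<\infty$, then $\rho_{n}=o(n^{\kappa})$; \item if $\kappa=\infty$, then there exists $l\in\mathbb{N}$ such that $\rho_{n}=o(n^{l})$. \end{itemize} Let $\{\mathbf{x}_{n}\}_{n=1}^{\infty}\subseteq[0,1]^{m}$ be arbitrary, and put $\gamma_{n}(t)=\rho_{n}\phi(\mathbf{x}_{n},t)$ for $t\in[0,1]$. Then the sequence of probability measures \[ \mu_{n}=\frac{1}{n}\sum_{k=1}^{n}\delta_{\pi(\gamma_{n}(k/n))} \] on $\mathbb{T}^{d}=\mathbb{R}^{d}/\mathbb{Z}^{d}$ equidistributes.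
   Context: $\pi:\mathbb{R}^{d}\to\mathbb{R}^{d}/\mathbb{Z}^{d}$ is the natural projection. A sequence of probability measures $\mu_n$ on $\mathbb{T}^d$ equidistributes if $\lim_{n\to\infty}\mu_{n}(f)=\int_{\mathbb{T}^{d}}f\,d\mathbf{x}$ for all continuous $f$ on $\mathbb{T}^{d}$, where $d\mathbf{x}$ is normalized Haar measure. "Analytic" means real analytic (on a neighbourhood of the closed domain). For a smooth curve $\gamma:[0,1]\to\mathbb{R}^{d}$ and $j\in\mathbb{N}$, let $\gamma^{(j)}=(\gamma_{1}^{(j)},\dots,\gamma_{d}^{(j)})$ be the componentwise $j$-th derivative. $\gamma$ is rationally non-degenerate (RND) of order $\kappa\in\mathbb{N}\cup\{\infty\}$ if $\kappa=\sup\{j\in\mathbb{N}: \text{for every }\mathbf{h}\in\mathbb{Z}^{d}\setminus\{\mathbf{0}\},\ t\mapsto\langle\mathbf{h},\gamma^{(j)}(t)\rangle\text{ is not identically zero}\}$. A family $\phi:[0,1]^{m}\times[0,1]\to\mathbb{R}^{d}$ of smooth curves is RND of order $\kappa$ if $\kappa=\inf\{\text{order of }\phi(\mathbf{x},\cdot):\mathbf{x}\in[0,1]^{m}\}$. *)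

theory Defs
  imports "HOL-Analysis.Analysis" "HOL-Library.Landau_Symbols" "HOL-Library.Extended_Nat"
begin

definition unit_cube :: "(real ^ 'm) set" where
  "unit_cube = {x. \<forall>i. 0 \<le> x $ i \<and> x $ i \<le> 1}"

definition int_vec :: "real ^ 'd \<Rightarrow> bool" where
  "int_vec h \<longleftrightarrow> (\<forall>i. h $ i \<in> \<int>)"

text \<open>Real analyticity of a family phi(x,t) on a set U of (x,t): near every point
  of U it is the sum of an (absolutely/unconditionally) convergent multivariate power
  series in the m+1 variables (x_1..x_m,t); multi-indices are 'm option => nat,
  with None standing for the t-variable.\<close>
definition real_analytic_family_on ::
  "(real ^ 'm \<Rightarrow> real \<Rightarrow> real ^ 'd) \<Rightarrow> ((real ^ 'm) \<times> real) set \<Rightarrow> bool" where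
  "real_analytic_family_on \<phi> U \<longleftrightarrow>
     (\<forall>(x0, t0) \<in> U. \<exists>r > 0. \<exists>c :: ('m option \<Rightarrow> nat) \<Rightarrow> real ^ 'd.
        \<forall>x t. dist (x, t) (x0, t0) < r \<longrightarrow>
          ((\<lambda>\<alpha>. ((\<Prod>i\<in>UNIV. (x $ i - x0 $ i) ^ \<alpha> (Some i)) * (t - t0) ^ \<alpha> None) *\<^sub>R c \<alpha>)
             has_sum \<phi> x t) UNIV)"

definition curve_deriv :: "nat \<Rightarrow> (real \<Rightarrow> real ^ 'd) \<Rightarrow> real \<Rightarrow> real ^ 'd" where
  "curve_deriv j \<gamma> t = (\<chi> i. (deriv ^^ j) (\<lambda>s. \<gamma> s $ i) t)"

definition rnd_order :: "(real \<Rightarrow> real ^ 'd) \<Rightarrow> enat" where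
  "rnd_order \<gamma> = Sup (enat ` {j. j \<ge> 1 \<and>
      (\<forall>h :: real ^ 'd. int_vec h \<and> h \<noteq> 0 \<longrightarrow>
         \<not> (\<forall>t \<in> {0..1}. h \<bullet> curve_deriv j \<gamma> t = 0))})"

definition rnd_order_family :: "(real ^ 'm \<Rightarrow> real \<Rightarrow> real ^ 'd) \<Rightarrow> enat" where
  "rnd_order_family \<phi> = (INF x \<in> unit_cube. rnd_order (\<phi> x))"

end

theory Submission
  imports Defs "HOL-Complex_Analysis.Cauchy_Integral_Formula"
begin

text \<open>By Weyl's criterion it suffices to bound the sums of \<open>cis (2 * pi * \<rho> n * g (x n) (k / n))\<close>, where
  \<open>g x t = h \<bullet> \<phi> x t\<close> for a nonzero integer vector \<open>h\<close>. Fix a finite \<open>K \<le> \<kappa>\<close> with \<open>\<rho> n = o(n ^ K)\<close> and pass to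
  a subsequence along which \<open>x n\<close> converges to some \<open>x0\<close>. The derivatives of \<open>g x0\<close> of order \<open>1, \<dots>, K\<close> are not
  identically zero, so by analyticity they have finitely many zeros in \<open>[0, 1]\<close>. Cut \<open>[0, 1]\<close> into
  \<open>Q\<close> equal cells: the boundedly many cells containing a zero are negligible for large \<open>Q\<close>, and on each of
  the others these derivatives of \<open>g (x n)\<close> are bounded away from zero with constant sign. There the sum is
  \<open>o(n)\<close> by induction on \<open>K\<close>: van der Corput's inequality replaces \<open>g\<close> by a difference quotient and \<open>\<rho>\<close> by
  \<open>s * \<rho> / n\<close> with a bounded shift \<open>s\<close>, and when \<open>\<rho> / n\<close> is small partial summation applies directly.\<close>

section \<open>Exponential sums with controlled finite differences\<close>

text \<open>The points \<open>x n\<close> are arbitrary, so every estimate has to be uniform near a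
  limit \<open>x0\<close>; this is why the sums are controlled only through conditions stable under
  perturbing \<open>x0\<close>, namely signs and sizes of derivatives on closed cells. Each
  differencing uses up one derivative and divides the amplitude by \<open>n\<close>, so amplitude
  o(n ^ K) is reduced to the first-order range in at most K - 1 rounds. In that range the phase
  increments are at most 1, hence no increment comes near a nonzero multiple of 2 pi and partial
  summation loses nothing to resonance. The amplitude may enter that range at any round, so all
  orders from 1 to \<open>K\<close> are needed, not just the top one. Non-degeneracy supplies them
  indirectly: the order is a supremum and yields only one order at least \<open>K\<close> at which
  the derivative of \<open>g x0\<close> does not vanish identically, but a lower derivative
  vanishing on the interval would make all higher ones vanish.\<close>

lemma van_der_Corput_inequality:
  fixes u :: "nat \<Rightarrow> complex"
  assumes H: "H \<ge> 1"
  shows "real H * (norm (\<Sum>k<N. u k))\<^sup>2 \<le>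
    real (N + H) * (norm (\<Sum>k<N. u k * cnj (u k)) + 2 * (\<Sum>h = 1..<H. norm (\<Sum>k<N - h. u (k + h) * cnj (u k))))"
proof -
  \<comment> \<open>\<open>a i\<close> is \<open>u\<close> moved right by \<open>i\<close> and
    padded with zeros. The \<open>H\<close> copies have equal sums and occupy \<open>N + H\<close>
    positions, so \<open>H\<close> times the sum is a sum over positions \<open>m\<close>, to which
    Cauchy-Schwarz applies.\<close>
  define a where "a i m = (if i \<le> m \<and> m < N + i then u (m - i) else 0)" for i m
  define C where "C h = (\<Sum>k<N - h. u (k + h) * cnj (u k))" for h
  define T where "T = norm (C 0) + 2 * (\<Sum>h = 1..<H. norm (C h))"
  have sum_a: "(\<Sum>m<N + H. a i m) = (\<Sum>k<N. u k)" if "i < H" for i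
  proof -
    have "(\<Sum>m<N + H. a i m) = (\<Sum>m\<in>{i..<N + i}. u (m - i))"
      unfolding a_def using that by (intro sum.mono_neutral_cong_right) auto
    also have "\<dots> = (\<Sum>k<N. u k)"
      by (intro sum.reindex_bij_witness[where i = "\<lambda>k. k + i" and j = "\<lambda>m. m - i"]) auto
    finally show ?thesis .
  qed
  have corr: "(\<Sum>m<N + H. a i m * cnj (a i' m)) = C (i' - i)" if "i \<le> i'" "i' < H" for i i'
  proof -
    have "(\<Sum>m<N + H. a i m * cnj (a i' m)) = (\<Sum>m\<in>{i'..<N + i}. u (m - i) * cnj (u (m - i')))"
      unfolding a_def using that by (intro sum.mono_neutral_cong_right) auto
    also have "\<dots> = C (i' - i)" unfolding C_def
      by (intro sum.reindex_bij_witness[where i = "\<lambda>k. k + i'" and j = "\<lambda>m. m - i'"])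
         (use that in \<open>auto simp: algebra_simps\<close>)
    finally show ?thesis .
  qed
  have corr_norm: "norm (\<Sum>m<N + H. a i m * cnj (a i' m)) = norm (C (if i \<le> i' then i' - i else i - i'))"
    if "i < H" "i' < H" for i i'
  proof (cases "i \<le> i'")
    case True
    then show ?thesis using corr that by simp
  next
    case False
    have "(\<Sum>m<N + H. a i m * cnj (a i' m)) = cnj (\<Sum>m<N + H. a i' m * cnj (a i m))"
      by (simp add: mult.commute)
    then show ?thesis using corr[of i' i] that False by (simp del: cnj_sum)
  qed
  \<comment> \<open>For fixed \<open>i\<close> the lag 0 occurs once and each positive lag at most
    twice, once on either side of \<open>i\<close>; hence the factor 2 in \<open>T\<close>.\<close>
  have row: "(\<Sum>i'<H. norm (C (if i \<le> i' then i' - i else i - i'))) \<le> T" if "i < H" for i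
  proof -
    have "{..<H} = {..<i} \<union> {i} \<union> {i<..<H}" using that by auto
    then have "(\<Sum>i'<H. norm (C (if i \<le> i' then i' - i else i - i'))) =
        (\<Sum>i'<i. norm (C (i - i'))) + norm (C 0) + (\<Sum>i'\<in>{i<..<H}. norm (C (i' - i)))"
      by (subst \<open>{..<H} = _\<close>, subst sum.union_disjoint, simp, simp, force, subst sum.union_disjoint) auto
    also have "(\<Sum>i'<i. norm (C (i - i'))) = (\<Sum>h\<in>{1..<Suc i}. norm (C h))"
      by (intro sum.reindex_bij_witness[where i = "\<lambda>k. i - k" and j = "\<lambda>m. i - m"]) auto
    also have "\<dots> \<le> (\<Sum>h = 1..<H. norm (C h))"
      using that by (intro sum_mono2) auto
    also have "(\<Sum>i'\<in>{i<..<H}. norm (C (i' - i))) = (\<Sum>h\<in>{1..<H - i}. norm (C h))"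
      by (intro sum.reindex_bij_witness[where i = "\<lambda>k. k + i" and j = "\<lambda>m. m - i"]) auto
    also have "\<dots> \<le> (\<Sum>h = 1..<H. norm (C h))"
      by (intro sum_mono2) auto
    finally show ?thesis unfolding T_def by simp
  qed
  have "complex_of_real (\<Sum>m<N + H. (norm (\<Sum>i<H. a i m))\<^sup>2) =
      (\<Sum>m<N + H. (\<Sum>i<H. \<Sum>i'<H. a i m * cnj (a i' m)))"
    by (simp add: complex_norm_square sum_product del: of_real_power)
  also have "\<dots> = (\<Sum>i<H. \<Sum>i'<H. \<Sum>m<N + H. a i m * cnj (a i' m))"
    by (subst sum.swap, rule sum.cong, simp, subst sum.swap) simp
  finally have eq: "complex_of_real (\<Sum>m<N + H. (norm (\<Sum>i<H. a i m))\<^sup>2) = \<dots>" .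
  have "(\<Sum>m<N + H. (norm (\<Sum>i<H. a i m))\<^sup>2) = norm (complex_of_real (\<Sum>m<N + H. (norm (\<Sum>i<H. a i m))\<^sup>2))"
    by (subst norm_of_real) (simp add: sum_nonneg)
  also have "\<dots> = norm (\<Sum>i<H. \<Sum>i'<H. \<Sum>m<N + H. a i m * cnj (a i' m))"
    unfolding eq ..
  also have "\<dots> \<le> (\<Sum>i<H. \<Sum>i'<H. norm (\<Sum>m<N + H. a i m * cnj (a i' m)))"
    by (intro order_trans[OF norm_sum] sum_mono order_refl)
  also have "\<dots> = (\<Sum>i<H. \<Sum>i'<H. norm (C (if i \<le> i' then i' - i else i - i')))"
    using corr_norm by (intro sum.cong refl) auto
  also have "\<dots> \<le> (\<Sum>i<H. T)"
    by (intro sum_mono row) auto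
  finally have sq: "(\<Sum>m<N + H. (norm (\<Sum>i<H. a i m))\<^sup>2) \<le> real H * T" by simp
  have "of_nat H * (\<Sum>k<N. u k) = (\<Sum>i<H. \<Sum>m<N + H. a i m)"
    using sum_a by simp
  also have "\<dots> = (\<Sum>m<N + H. \<Sum>i<H. a i m)" by (rule sum.swap)
  finally have HS: "of_nat H * (\<Sum>k<N. u k) = \<dots>" .
  have "(real H * norm (\<Sum>k<N. u k))\<^sup>2 = (norm (\<Sum>m<N + H. \<Sum>i<H. a i m))\<^sup>2"
    by (subst HS[symmetric]) (simp add: norm_mult)
  also have "\<dots> \<le> (\<Sum>m<N + H. norm (\<Sum>i<H. a i m))\<^sup>2"
    by (intro power_mono norm_sum) auto
  also have "\<dots> \<le> (\<Sum>m<N + H. (norm (\<Sum>i<H. a i m))\<^sup>2) * real (N + H)"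
    using sum_squared_le_sum_of_squares[of "\<lambda>m. norm (\<Sum>i<H. a i m)" "{..<N+H}"] by simp
  also have "\<dots> \<le> real H * T * real (N + H)"
    by (intro mult_right_mono sq) auto
  finally have "real H * (real H * (norm (\<Sum>k<N. u k))\<^sup>2) \<le> real H * (real (N + H) * T)"
    by (simp add: power2_eq_square algebra_simps)
  then have "real H * (norm (\<Sum>k<N. u k))\<^sup>2 \<le> real (N + H) * T"
    using H by (simp add: mult_le_cancel_left_pos)
  then show ?thesis unfolding T_def C_def by simp
qed

definition fwd_diff :: "(nat \<Rightarrow> real) \<Rightarrow> nat \<Rightarrow> real" where
  "fwd_diff F k = F (Suc k) - F k"

text \<open>Keeps the denominators of the partial summation away from 0: on [0, 1] the sine is at
  least y - y^2 / 2, hence at least y / 2.\<close>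

lemma abs_half_le_norm_cis_minus_1:
  assumes "\<bar>x\<bar> \<le> 1"
  shows "\<bar>x\<bar> / 2 \<le> norm (cis x - 1)"
proof -
  have *: "\<bar>y\<bar> / 2 \<le> \<bar>sin y\<bar>" if y: "0 \<le> y" "y \<le> 1" for y :: real
  proof -
    have "\<bar>sin y - (\<Sum>m<2. sin_coeff m * y ^ m)\<bar> \<le> inverse (fact 2) * \<bar>y\<bar> ^ 2"
      by (rule Maclaurin_sin_bound)
    then have "\<bar>sin y - y\<bar> \<le> y\<^sup>2 / 2" by (simp add: sin_coeff_def eval_nat_numeral)
    moreover have "y\<^sup>2 \<le> y" using y by (simp add: power2_eq_square mult_left_le)
    ultimately show ?thesis using y by linarith
  qed
  have "\<bar>x\<bar> / 2 \<le> \<bar>sin x\<bar>"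
    using *[of x] *[of "-x"] assms by (cases "x \<ge> 0") auto
  also have "\<dots> = \<bar>Im (cis x - 1)\<bar>" by simp
  also have "\<dots> \<le> norm (cis x - 1)" by (rule abs_Im_le_cmod)
  finally show ?thesis .
qed

lemma norm_cis_diff_le: "norm (cis x - cis y) \<le> \<bar>x - y\<bar>"
proof -
  have "cis x - cis y = cis y * (cis (x - y) - 1)"
    by (simp add: right_diff_distrib cis_mult)
  then have "norm (cis x - cis y) = norm (cis (x - y) - 1)"
    by (simp add: norm_mult)
  also have "\<dots> \<le> \<bar>x - y\<bar>"
    using norm_exp_i_times[of "x - y"] dist_exp_i_1[of "x - y"] abs_sin_le_one[of "(x-y)/2"]
      abs_sin_x_le_abs_x[of "(x - y)/2"]
    by (simp add: dist_norm cis_conv_exp mult.commute)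
  finally show ?thesis .
qed

text \<open>Partial summation with the weights \<open>1 / (cis (\<Delta>F) - 1)\<close>, for which
  \<open>cis (F k) = w k * (cis (F (k + 1)) - cis (F k))\<close>.\<close>

lemma exp_sum_bound_of_small_differences:
  fixes F :: "nat \<Rightarrow> real"
  assumes \<theta>: "\<theta> > 0" and \<eta>: "\<eta> \<ge> 0"
    and lower: "\<And>k. k + 1 < N \<Longrightarrow> \<theta> \<le> \<bar>fwd_diff F k\<bar>"
    and upper: "\<And>k. k + 1 < N \<Longrightarrow> \<bar>fwd_diff F k\<bar> \<le> 1"
    and second: "\<And>k. k + 2 < N \<Longrightarrow> \<bar>fwd_diff (fwd_diff F) k\<bar> \<le> \<eta>"
  shows "norm (\<Sum>k<N. cis (F k)) \<le> 1 + 4 / \<theta> + 4 * real N * \<eta> / \<theta>\<^sup>2"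
proof -
  define d where "d k = cis (fwd_diff F k) - 1" for k
  have step: "cis (F (Suc k)) - cis (F k) = cis (F k) * d k" for k
    by (simp add: d_def fwd_diff_def right_diff_distrib cis_mult)
  have dlow: "\<theta> / 2 \<le> norm (d k)" if "k + 1 < N" for k
    using abs_half_le_norm_cis_minus_1[OF upper[OF that]] lower[OF that] unfolding d_def by linarith
  have d0: "d k \<noteq> 0" if "k + 1 < N" for k using dlow[OF that] \<theta> by auto
  have wle: "norm (1 / d k) \<le> 2 / \<theta>" if "k + 1 < N" for k
    using dlow[OF that] \<theta> by (simp add: norm_divide field_simps d0[OF that])
  have wdiff: "norm (1 / d (Suc k) - 1 / d k) \<le> 4 * \<eta> / \<theta>\<^sup>2" if "k + 2 < N" for k
  proof -
    have "1 / d (Suc k) - 1 / d k = (1 / d (Suc k)) * (1 / d k) * (d k - d (Suc k))"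
      using d0[of k] d0[of "Suc k"] that by (simp add: field_simps)
    then have "norm (1 / d (Suc k) - 1 / d k) = norm (1 / d (Suc k)) * norm (1 / d k) * norm (d k - d (Suc k))"
      by (metis norm_mult)
    also have "\<dots> \<le> (2 / \<theta>) * (2 / \<theta>) * \<eta>"
    proof (intro mult_mono wle)
      show "norm (d k - d (Suc k)) \<le> \<eta>"
        using norm_cis_diff_le[of "fwd_diff F k" "fwd_diff F (Suc k)"] second[OF that]
        by (simp add: d_def fwd_diff_def)
    qed (use that \<theta> in auto)
    finally show ?thesis by (simp add: power2_eq_square)
  qed
  \<comment> \<open>With the boundary term of the partial summation subtracted, one more summand
    costs only one difference of consecutive weights.\<close>
  have main: "norm ((\<Sum>k<M. cis (F k)) - cis (F M) / d (M - 1)) \<le> 2 / \<theta> + 4 * real M * \<eta> / \<theta>\<^sup>2"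
    if "M \<ge> 1" "M < N" for M using that
  proof (induction M rule: nat_induct_at_least)
    case base
    have "(\<Sum>k<1. cis (F k)) - cis (F 1) / d 0 = - cis (F 0) / d 0"
      using step[of 0] d0[of 0] base by (simp add: field_simps)
    then have "norm ((\<Sum>k<1. cis (F k)) - cis (F 1) / d 0) = norm (1 / d 0)"
      by (simp add: norm_divide)
    also have "\<dots> \<le> 2 / \<theta>" using wle[of 0] base by simp
    finally show ?case using \<eta> by (simp add: add_increasing2)
  next
    case (Suc M)
    have dM: "d M \<noteq> 0" "d (M - 1) \<noteq> 0" using d0 Suc by auto
    have "cis (F M) = (cis (F (Suc M)) - cis (F M)) / d M"
      using step[of M] dM by (simp add: field_simps)
    then have "(\<Sum>k<Suc M. cis (F k)) - cis (F (Suc M)) / d M =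
      ((\<Sum>k<M. cis (F k)) - cis (F M) / d (M - 1)) + cis (F M) * (1 / d (M - 1) - 1 / d M)"
      by (simp add: field_simps diff_divide_distrib)
    then have "norm ((\<Sum>k<Suc M. cis (F k)) - cis (F (Suc M)) / d M) \<le>
      norm ((\<Sum>k<M. cis (F k)) - cis (F M) / d (M - 1)) + norm (cis (F M) * (1 / d (M - 1) - 1 / d M))"
      by (metis norm_triangle_ineq)
    also have "norm (cis (F M) * (1 / d (M - 1) - 1 / d M)) = norm (1 / d M - 1 / d (M - 1))"
      by (simp add: norm_mult norm_minus_commute)
    also have "\<dots> \<le> 4 * \<eta> / \<theta>\<^sup>2" using wdiff[of "M - 1"] Suc by simp
    finally show ?case using Suc by (simp add: field_simps add_divide_distrib)
  qed
  show ?thesis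
  proof (cases "N \<le> 1")
    case True
    then have "N = 0 \<or> N = 1" by auto
    then show ?thesis using \<theta> \<eta> by auto
  next
    case False
    \<comment> \<open>The last sample has no increment inside the range. It is split off and
      contributes the 1; the boundary term contributes a second \<open>2 / \<theta>\<close>.\<close>
    define M where "M = N - 1"
    have M: "M \<ge> 1" "M < N" "N = Suc M" using False by (auto simp: M_def)
    have "norm (\<Sum>k<N. cis (F k)) = norm (((\<Sum>k<M. cis (F k)) - cis (F M) / d (M - 1)) + cis (F M) / d (M - 1) + cis (F M))"
      using M by simp
    also have "\<dots> \<le> norm ((\<Sum>k<M. cis (F k)) - cis (F M) / d (M - 1)) + norm (cis (F M) / d (M - 1)) + norm (cis (F M))"
      by (intro norm_triangle_mono order_refl)
    also have "\<dots> \<le> (2 / \<theta> + 4 * real M * \<eta> / \<theta>\<^sup>2) + 2 / \<theta> + 1"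
      using main[of M] wle[of "M - 1"] M by (intro add_mono) (auto simp: norm_divide)
    also have "\<dots> \<le> 1 + 4 / \<theta> + 4 * real N * \<eta> / \<theta>\<^sup>2"
      using M \<eta> \<theta> by (simp add: field_simps)
    finally show ?thesis .
  qed
qed

section \<open>Iterated finite differences and the inductive estimate\<close>

lemma fwd_diff_funpow_shift:
  "(fwd_diff ^^ j) (\<lambda>k. F (k + h) - F k) k = (fwd_diff ^^ j) F (k + h) - (fwd_diff ^^ j) F k"
  by (induction j arbitrary: k) (simp_all add: fwd_diff_def)

lemma fwd_diff_funpow_shift_sum:
  "(fwd_diff ^^ j) (\<lambda>k. F (k + h) - F k) k = (\<Sum>i<h. (fwd_diff ^^ Suc j) F (k + i))"
proof -
  have "(\<Sum>i<h. (fwd_diff ^^ Suc j) F (k + i)) = (\<Sum>i<h. (fwd_diff ^^ j) F (k + Suc i) - (fwd_diff ^^ j) F (k + i))"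
    by (simp add: fwd_diff_def)
  also have "\<dots> = (fwd_diff ^^ j) F (k + h) - (fwd_diff ^^ j) F k"
    by (subst sum_lessThan_telescope) simp
  finally show ?thesis by (simp add: fwd_diff_funpow_shift)
qed

text \<open>The first \<open>N\<close> values of \<open>F\<close> behave like samples \<open>\<rho> * g (k / n)\<close> of a function whose derivatives
  of order \<open>1, \<dots>, K\<close> have constant sign and absolute value in \<open>[c, C]\<close>, and whose derivative of order
  \<open>K + 1\<close> is bounded by \<open>C\<close>.\<close>

definition sample_bounds :: "nat \<Rightarrow> real \<Rightarrow> real \<Rightarrow> real \<Rightarrow> nat \<Rightarrow> nat \<Rightarrow> (nat \<Rightarrow> real) \<Rightarrow> bool" where
  "sample_bounds K c C \<rho> n N F \<longleftrightarrow>
    (\<forall>j\<in>{1..K}. \<exists>\<sigma>\<in>{-1, 1}. \<forall>k. k + j < N \<longrightarrow>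
       c * \<rho> / real n ^ j \<le> \<sigma> * (fwd_diff ^^ j) F k \<and> \<sigma> * (fwd_diff ^^ j) F k \<le> C * \<rho> / real n ^ j) \<and>
    (\<forall>k. k + Suc K < N \<longrightarrow> \<bar>(fwd_diff ^^ Suc K) F k\<bar> \<le> C * \<rho> / real n ^ Suc K)"

text \<open>A difference of order \<open>j\<close> of the shifted phase is a sum of \<open>h\<close>
  differences of order \<open>j + 1\<close>. These share one sign, so the lower bounds add up
  without cancellation. The factor \<open>h / n\<close> goes into \<open>\<rho>\<close>, and
  \<open>c\<close> and \<open>C\<close> survive the induction unchanged.\<close>

lemma sample_bounds_shift_diff:
  assumes "sample_bounds (Suc K) c C \<rho> n N F"
  shows "sample_bounds K c C (real h * \<rho> / real n) n (N - h) (\<lambda>k. F (k + h) - F k)"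
  unfolding sample_bounds_def
proof (intro conjI ballI allI impI)
  fix j assume j: "j \<in> {1..K}"
  then obtain \<sigma> where \<sigma>: "\<sigma> \<in> {-1, 1}" and b: "\<And>k. k + Suc j < N \<Longrightarrow>
       c * \<rho> / real n ^ Suc j \<le> \<sigma> * (fwd_diff ^^ Suc j) F k \<and> \<sigma> * (fwd_diff ^^ Suc j) F k \<le> C * \<rho> / real n ^ Suc j"
    using assms unfolding sample_bounds_def by (metis Suc_le_mono atLeastAtMost_iff le_SucI)
  have "c * (real h * \<rho> / real n) / real n ^ j \<le> \<sigma> * (fwd_diff ^^ j) (\<lambda>k. F (k + h) - F k) k \<and>
      \<sigma> * (fwd_diff ^^ j) (\<lambda>k. F (k + h) - F k) k \<le> C * (real h * \<rho> / real n) / real n ^ j"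
    if k: "k + j < N - h" for k
  proof -
    have "(\<Sum>i<h. c * \<rho> / real n ^ Suc j) \<le> (\<Sum>i<h. \<sigma> * (fwd_diff ^^ Suc j) F (k + i))"
      using b k by (intro sum_mono) auto
    moreover have "(\<Sum>i<h. \<sigma> * (fwd_diff ^^ Suc j) F (k + i)) \<le> (\<Sum>i<h. C * \<rho> / real n ^ Suc j)"
      using b k by (intro sum_mono) auto
    ultimately show ?thesis
      unfolding fwd_diff_funpow_shift_sum sum_distrib_left by (simp add: mult_ac)
  qed
  then show "\<exists>\<sigma>\<in>{-1, 1}. \<forall>k. k + j < N - h \<longrightarrow>
      c * (real h * \<rho> / real n) / real n ^ j \<le> \<sigma> * (fwd_diff ^^ j) (\<lambda>k. F (k + h) - F k) k \<and>
      \<sigma> * (fwd_diff ^^ j) (\<lambda>k. F (k + h) - F k) k \<le> C * (real h * \<rho> / real n) / real n ^ j"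
    using \<sigma> by blast
next
  fix k assume k: "k + Suc K < N - h"
  have b: "\<bar>(fwd_diff ^^ Suc (Suc K)) F i\<bar> \<le> C * \<rho> / real n ^ Suc (Suc K)" if "i + Suc (Suc K) < N" for i
    using assms that unfolding sample_bounds_def by blast
  have "\<bar>(fwd_diff ^^ Suc K) (\<lambda>k. F (k + h) - F k) k\<bar> \<le> (\<Sum>i<h. \<bar>(fwd_diff ^^ Suc (Suc K)) F (k + i)\<bar>)"
    unfolding fwd_diff_funpow_shift_sum by (rule sum_abs)
  also have "\<dots> \<le> (\<Sum>i<h. C * \<rho> / real n ^ Suc (Suc K))"
    using b k by (intro sum_mono) auto
  finally show "\<bar>(fwd_diff ^^ Suc K) (\<lambda>k. F (k + h) - F k) k\<bar> \<le> C * (real h * \<rho> / real n) / real n ^ Suc K"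
    by (simp add: mult_ac)
qed

text \<open>For \<open>K\<close> at least 2 the required bound on the absolute second difference
  comes from the signed bounds of order 2, whose lower end is nonnegative.\<close>

lemma sample_bounds_one:
  assumes "sample_bounds K c C \<rho> n N F" "K \<ge> 1" "c \<ge> 0" "\<rho> \<ge> 0"
  shows "sample_bounds 1 c C \<rho> n N F"
proof (cases "K = 1")
  case False
  then have "1 \<in> {1..K}" "2 \<in> {1..K}" using assms(2) by auto
  obtain \<sigma> where \<sigma>: "\<sigma> \<in> {-1, 1}" and b: "\<And>k. k + 2 < N \<Longrightarrow>
       c * \<rho> / real n ^ 2 \<le> \<sigma> * (fwd_diff ^^ 2) F k \<and> \<sigma> * (fwd_diff ^^ 2) F k \<le> C * \<rho> / real n ^ 2"
    using assms(1) \<open>2 \<in> {1..K}\<close> unfolding sample_bounds_def by blast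
  have c0: "0 \<le> c * \<rho> / real n ^ 2" using assms by simp
  have "\<bar>(fwd_diff ^^ 2) F k\<bar> \<le> C * \<rho> / real n ^ 2" if "k + 2 < N" for k
    using b[OF that] c0 \<sigma> by auto
  then have two: "\<forall>k. k + Suc 1 < N \<longrightarrow> \<bar>(fwd_diff ^^ Suc 1) F k\<bar> \<le> C * \<rho> / real n ^ Suc 1"
    by (simp add: numeral_2_eq_2)
  have "\<exists>\<sigma>\<in>{-1, 1}. \<forall>k. k + 1 < N \<longrightarrow>
       c * \<rho> / real n ^ 1 \<le> \<sigma> * (fwd_diff ^^ 1) F k \<and> \<sigma> * (fwd_diff ^^ 1) F k \<le> C * \<rho> / real n ^ 1"
    using assms(1) \<open>1 \<in> {1..K}\<close> unfolding sample_bounds_def by blast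
  with two show ?thesis
    unfolding sample_bounds_def atLeastAtMost_singleton by blast
qed (use assms in simp)

text \<open>Increments of size at least c \<rho> / n and second differences of size at most C \<rho>
  / n^2 turn partial summation into a bound 1 + O(n / \<rho>). \<open>R\<close> makes the second
  part at most a third of \<epsilon> n, \<open>n0\<close> does the same for the 1, and \<delta> = 1
  / C keeps the increments at most 1.\<close>

lemma exp_sum_small_order_one:
  assumes c: "c > 0" and C: "C > 0" and \<epsilon>: "\<epsilon> > 0"
  shows "\<exists>R>0. \<exists>\<delta>>0. \<exists>n0. \<forall>n\<ge>n0. \<forall>N\<le>n. \<forall>\<rho> F. R \<le> \<rho> \<longrightarrow> \<rho> \<le> \<delta> * real n \<longrightarrow>
    sample_bounds 1 c C \<rho> n N F \<longrightarrow> norm (\<Sum>k<N. cis (F k)) \<le> \<epsilon> * real n"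
proof -
  define R where "R = (12 / c + 12 * C / c\<^sup>2) / \<epsilon>"
  define n0 where "n0 = nat \<lceil>3 / \<epsilon>\<rceil> + 1"
  have R: "R > 0" unfolding R_def using c C \<epsilon> by (simp add: add_pos_pos)
  have "norm (\<Sum>k<N. cis (F k)) \<le> \<epsilon> * real n"
    if n: "n \<ge> n0" and N: "N \<le> n" and \<rho>: "R \<le> \<rho>" "\<rho> \<le> 1 / C * real n" and F: "sample_bounds 1 c C \<rho> n N F"
    for n N \<rho> F
  proof -
    have n1: "real n \<ge> 3 / \<epsilon>" "n \<ge> 1" using n unfolding n0_def by linarith+
    have \<rho>0: "\<rho> > 0" using R \<rho> by simp
    obtain \<sigma> where \<sigma>: "\<sigma> \<in> {-1, 1}" and "\<And>k. k + 1 < N \<Longrightarrow>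
       c * \<rho> / real n ^ 1 \<le> \<sigma> * (fwd_diff ^^ 1) F k \<and> \<sigma> * (fwd_diff ^^ 1) F k \<le> C * \<rho> / real n ^ 1"
      using F unfolding sample_bounds_def atLeastAtMost_singleton by blast
    then have b: "\<And>k. k + 1 < N \<Longrightarrow>
       c * \<rho> / real n \<le> \<sigma> * fwd_diff F k \<and> \<sigma> * fwd_diff F k \<le> C * \<rho> / real n"
      by simp
    have pos: "0 < c * \<rho> / real n" using c \<rho>0 n1 by simp
    have abs: "\<bar>fwd_diff F k\<bar> = \<sigma> * fwd_diff F k" if "k + 1 < N" for k
      using b[OF that] \<sigma> pos by auto
    have "norm (\<Sum>k<N. cis (F k)) \<le> 1 + 4 / (c * \<rho> / real n) + 4 * real N * (C * \<rho> / (real n)\<^sup>2) / (c * \<rho> / real n)\<^sup>2"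
    proof (rule exp_sum_bound_of_small_differences)
      show "\<bar>fwd_diff F k\<bar> \<le> 1" if "k + 1 < N" for k
      proof -
        have "C * \<rho> / real n \<le> 1" using \<rho>(2) C n1 by (simp add: field_simps)
        then show ?thesis using b[OF that] abs[OF that] by simp
      qed
      show "\<bar>fwd_diff (fwd_diff F) k\<bar> \<le> C * \<rho> / (real n)\<^sup>2" if "k + 2 < N" for k
        using F that unfolding sample_bounds_def by (simp add: power2_eq_square)
    qed (use pos b abs C \<rho>0 in auto)
    also have "4 * real N * (C * \<rho> / (real n)\<^sup>2) / (c * \<rho> / real n)\<^sup>2 = 4 * real N * C / (c\<^sup>2 * \<rho>)"
      using n1 \<rho>0 c by (simp add: field_simps power2_eq_square)
    also have "\<dots> \<le> 4 * real n * C / (c\<^sup>2 * \<rho>)"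
      using N C \<rho>0 c by (intro divide_right_mono mult_right_mono) auto
    also have "1 + 4 / (c * \<rho> / real n) + 4 * real n * C / (c\<^sup>2 * \<rho>) = 1 + real n * (4 / c + 4 * C / c\<^sup>2) / \<rho>"
      using n1 \<rho>0 c by (simp add: field_simps power2_eq_square)
    also have "\<dots> \<le> \<epsilon> * real n / 3 + \<epsilon> * real n / 3"
    proof (rule add_mono)
      show "1 \<le> \<epsilon> * real n / 3" using n1 \<epsilon> by (simp add: field_simps)
      have "12 / c + 12 * C / c\<^sup>2 \<le> \<epsilon> * \<rho>" using \<rho>(1) \<epsilon> unfolding R_def by (simp add: field_simps)
      then have "real n * (12 / c + 12 * C / c\<^sup>2) \<le> real n * (\<epsilon> * \<rho>)" by (intro mult_left_mono) auto
      then show "real n * (4 / c + 4 * C / c\<^sup>2) / \<rho> \<le> \<epsilon> * real n / 3"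
        using \<rho>0 by (simp add: field_simps)
    qed
    also have "\<dots> \<le> \<epsilon> * real n" using \<epsilon> by simp
    finally show ?thesis by simp
  qed
  then show ?thesis using R C by (intro exI[of _ R] exI[of _ "1 / C"] exI[of _ n0] conjI) auto
qed

text \<open>In the induction step, differencing by \<open>h\<close> turns the parameter \<open>\<rho>\<close> into \<open>h * \<rho> / n\<close>. It may fail to be
  large for the first few \<open>h\<close>, whose contribution is negligible as soon as \<open>\<rho> / n\<close> is bounded below;
  otherwise the case of order one applies directly.\<close>

lemma exp_sum_small:
  assumes K: "K \<ge> 1" and c: "c > 0" and C: "C > 0" and \<epsilon>: "\<epsilon> > 0"
  shows "\<exists>R>0. \<exists>\<delta>>0. \<exists>n0. \<forall>n\<ge>n0. \<forall>N\<le>n. \<forall>\<rho> F. R \<le> \<rho> \<longrightarrow> \<rho> \<le> \<delta> * real n ^ K \<longrightarrow>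
    sample_bounds K c C \<rho> n N F \<longrightarrow> norm (\<Sum>k<N. cis (F k)) \<le> \<epsilon> * real n"
  using K \<epsilon>
proof (induction K arbitrary: \<epsilon> rule: nat_induct_at_least)
  case base
  then show ?case using exp_sum_small_order_one[OF c C] by simp
next
  case (Suc K)
  have \<epsilon>: "\<epsilon> > 0" by fact
  \<comment> \<open>Van der Corput bounds the square of the sum, so the correlations must be small
    on the scale of \<epsilon> squared. With \<open>N + H \<le> 2 * n\<close> their share below is H
    \<epsilon>^2 / 4 times n^2.\<close>
  have "\<epsilon>\<^sup>2 / 16 > 0" using \<epsilon> by simp
  from Suc.IH[OF this] obtain R1 \<delta>1 n1 where 1: "R1 > 0" "\<delta>1 > 0" and
    small1: "\<forall>n\<ge>n1. \<forall>N\<le>n. \<forall>\<rho> F. R1 \<le> \<rho> \<longrightarrow> \<rho> \<le> \<delta>1 * real n ^ K \<longrightarrow>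
      sample_bounds K c C \<rho> n N F \<longrightarrow> norm (\<Sum>k<N. cis (F k)) \<le> \<epsilon>\<^sup>2 / 16 * real n"
    by (elim exE conjE)
  from exp_sum_small_order_one[OF c C \<epsilon>] obtain R0 \<delta>0 n0 where 0: "R0 > 0" "\<delta>0 > 0" and
    small0: "\<forall>n\<ge>n0. \<forall>N\<le>n. \<forall>\<rho> F. R0 \<le> \<rho> \<longrightarrow> \<rho> \<le> \<delta>0 * real n \<longrightarrow>
      sample_bounds 1 c C \<rho> n N F \<longrightarrow> norm (\<Sum>k<N. cis (F k)) \<le> \<epsilon> * real n"
    by (elim exE conjE)
  \<comment> \<open>Outside the first-order range \<open>\<rho> / n\<close> exceeds
    \<open>\<delta>0\<close>, so every shift \<open>h \<ge> h1\<close> has h \<rho> / n at least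
    \<open>R1\<close>. The shifts below \<open>h1\<close> receive the trivial bound
    \<open>n\<close>.\<close>
  obtain h1 :: nat where h1: "R1 \<le> real h1 * \<delta>0"
    using reals_Archimedean3[OF 0(2)] by (metis less_imp_le)
  \<comment> \<open>Gives 2 + 4 h1 at most H \<epsilon>^2 / 2; the 2 stems from the diagonal term
    and 4 h1 from the trivially bounded shifts. Together with the share H \<epsilon>^2 / 4 of the
    other shifts this stays below H \<epsilon>^2.\<close>
  define H where "H = nat \<lceil>(2 + 4 * real h1) * 2 / \<epsilon>\<^sup>2\<rceil> + 1"
  have H1: "H \<ge> 1" unfolding H_def by simp
  have "real H \<ge> (2 + 4 * real h1) * 2 / \<epsilon>\<^sup>2" unfolding H_def by linarith
  then have HH: "2 + 4 * real h1 \<le> real H * \<epsilon>\<^sup>2 / 2" using \<epsilon> by (simp add: field_simps)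
  define m where "m = max (max n0 n1) H"
  have "norm (\<Sum>k<N. cis (F k)) \<le> \<epsilon> * real n"
    \<comment> \<open>Dividing \<open>\<delta>1\<close> by \<open>H\<close> keeps h \<rho> / n
      within the range of the induction hypothesis for all \<open>h < H\<close>.\<close>
    if n: "n \<ge> m" and N: "N \<le> n" and \<rho>: "R0 \<le> \<rho>" "\<rho> \<le> \<delta>1 / real H * real n ^ Suc K"
      and F: "sample_bounds (Suc K) c C \<rho> n N F" for n N \<rho> F
  proof (cases "\<rho> \<le> \<delta>0 * real n")
    case True
    then show ?thesis
      using small0 n N \<rho> sample_bounds_one[OF F] c 0 unfolding m_def by auto
  next
    case False
    have n': "n \<ge> n1" "n \<ge> H" "n \<ge> 1" using n H1 unfolding m_def by auto
    have \<rho>0: "\<rho> > 0" using \<rho> 0 by simp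
    have cisF: "(\<Sum>k<M. cis (F (k + h)) * cnj (cis (F k))) = (\<Sum>k<M. cis (F (k + h) - F k))" for h M
      by (simp add: cis_cnj cis_mult)
    have triv: "norm (\<Sum>k<M. cis (F (k + h)) * cnj (cis (F k))) \<le> real M" for h M
      unfolding cisF by (rule order_trans[OF norm_sum]) simp
    have corr: "norm (\<Sum>k<N - h. cis (F (k + h)) * cnj (cis (F k))) \<le>
        (if h < h1 then real n else 0) + \<epsilon>\<^sup>2 / 16 * real n" if h: "h \<in> {1..<H}" for h
    proof (cases "h < h1")
      case True
      have "norm (\<Sum>k<N - h. cis (F (k + h)) * cnj (cis (F k))) \<le> real n"
        by (rule order_trans[OF triv]) (use N in simp)
      then show ?thesis using True by (simp add: add_increasing2)
    next
      case nh: False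
      have "norm (\<Sum>k<N - h. cis (F (k + h) - F k)) \<le> \<epsilon>\<^sup>2 / 16 * real n"
      proof (rule small1[rule_format, OF _ _ _ _ sample_bounds_shift_diff[OF F]])
        have "R1 \<le> real h1 * \<delta>0" by (rule h1)
        also have "\<dots> \<le> real h * (\<rho> / real n)"
          using nh False n' 0 by (intro mult_mono) (auto simp: field_simps)
        finally show "R1 \<le> real h * \<rho> / real n" by simp
        have "real h * \<rho> / real n \<le> real H * (\<delta>1 / real H * real n ^ Suc K) / real n"
          using h \<rho> \<rho>0 by (intro divide_right_mono mult_mono) auto
        also have "\<dots> = \<delta>1 * real n ^ K" using H1 n' by (simp add: field_simps)
        finally show "real h * \<rho> / real n \<le> \<delta>1 * real n ^ K" .
      qed (use n' N in auto)
      then show ?thesis using nh unfolding cisF by simp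
    qed
    have "(\<Sum>h = 1..<H. norm (\<Sum>k<N - h. cis (F (k + h)) * cnj (cis (F k)))) \<le>
        (\<Sum>h = 1..<H. (if h < h1 then real n else 0) + \<epsilon>\<^sup>2 / 16 * real n)"
      by (rule sum_mono[OF corr])
    also have "\<dots> = (\<Sum>h\<in>{1..<H} \<inter> {h. h < h1}. real n) + real (H - 1) * (\<epsilon>\<^sup>2 / 16 * real n)"
      by (simp add: sum.distrib sum.inter_restrict[symmetric] sum.If_cases)
    also have "\<dots> \<le> real h1 * real n + real H * (\<epsilon>\<^sup>2 / 16 * real n)"
    proof (rule add_mono)
      have "card ({1..<H} \<inter> {h. h < h1}) \<le> card {..<h1}" by (rule card_mono) auto
      then show "(\<Sum>h\<in>{1..<H} \<inter> {h. h < h1}. real n) \<le> real h1 * real n"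
        by (simp add: mult_right_mono)
    qed (use \<epsilon> in \<open>auto intro!: mult_right_mono\<close>)
    finally have sumcorr: "(\<Sum>h = 1..<H. norm (\<Sum>k<N - h. cis (F (k + h)) * cnj (cis (F k)))) \<le> \<dots>" .
    have "real H * (norm (\<Sum>k<N. cis (F k)))\<^sup>2 \<le> real (N + H) * (norm (\<Sum>k<N. cis (F k) * cnj (cis (F k))) +
        2 * (\<Sum>h = 1..<H. norm (\<Sum>k<N - h. cis (F (k + h)) * cnj (cis (F k)))))"
      by (rule van_der_Corput_inequality[OF H1])
    also have "\<dots> \<le> (2 * real n) * (real n + 2 * (real h1 * real n + real H * (\<epsilon>\<^sup>2 / 16 * real n)))"
      using triv[where h = 0 and M = N] N n' sumcorr \<epsilon>
      by (intro mult_mono add_mono) (auto intro!: sum_nonneg add_nonneg_nonneg)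
    also have "\<dots> = (real n)\<^sup>2 * (2 + 4 * real h1 + real H * \<epsilon>\<^sup>2 / 4)"
      by (simp add: field_simps power2_eq_square)
    also have "\<dots> \<le> (real n)\<^sup>2 * (real H * \<epsilon>\<^sup>2)"
      using HH by (intro mult_left_mono) auto
    also have "\<dots> = real H * (\<epsilon> * real n)\<^sup>2" by (simp add: power2_eq_square)
    finally have "(norm (\<Sum>k<N. cis (F k)))\<^sup>2 \<le> (\<epsilon> * real n)\<^sup>2"
      using H1 by (simp add: mult_le_cancel_left_pos)
    then show ?thesis by (rule power2_le_imp_le) (use \<epsilon> in simp)
  qed
  moreover have "\<delta>1 / real H > 0" using 1 H1 by simp
  ultimately show ?case using 0(1) by (intro exI[of _ R0] exI[of _ "\<delta>1 / real H"] exI[of _ m] conjI) auto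
qed

text \<open>A mean value theorem for iterated differences. The induction replaces the whole
  derivative chain by its differences \<open>D\<close> with step \<open>s\<close>, on an interval
  shortened by \<open>s\<close>; letting \<open>G\<close> be any chain of derivatives makes the
  hypothesis pass to \<open>D\<close>.\<close>

lemma fwd_diff_funpow_bounds:
  fixes G :: "nat \<Rightarrow> real \<Rightarrow> real"
  assumes "s > 0"
    and "\<And>i t. i < j \<Longrightarrow> t \<in> {a..b} \<Longrightarrow> (G i has_real_derivative G (Suc i) t) (at t)"
    and "\<And>t. t \<in> {a..b} \<Longrightarrow> l \<le> G j t \<and> G j t \<le> u"
    and "a \<le> t0 + real k * s" "t0 + real (k + j) * s \<le> b"
  shows "l * s ^ j \<le> (fwd_diff ^^ j) (\<lambda>k. G 0 (t0 + real k * s)) k \<and>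
         (fwd_diff ^^ j) (\<lambda>k. G 0 (t0 + real k * s)) k \<le> u * s ^ j"
  using assms
proof (induction j arbitrary: G b l u)
  case 0
  then show ?case by auto
next
  case (Suc j)
  define D where "D i t = G i (t + s) - G i t" for i t
  have "(l * s) * s ^ j \<le> (fwd_diff ^^ j) (\<lambda>k. D 0 (t0 + real k * s)) k \<and>
         (fwd_diff ^^ j) (\<lambda>k. D 0 (t0 + real k * s)) k \<le> (u * s) * s ^ j"
  proof (rule Suc.IH[where b = "b - s"])
    fix i t assume i: "i < j" and t: "t \<in> {a..b - s}"
    have "((\<lambda>t. G i (t + s)) has_real_derivative G (Suc i) (t + s)) (at t)"
      using Suc.prems(2)[of i "t + s"] i t \<open>s > 0\<close> by (subst DERIV_shift[symmetric]) auto
    moreover have "(G i has_real_derivative G (Suc i) t) (at t)"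
      using Suc.prems(2)[of i t] i t \<open>s > 0\<close> by auto
    ultimately show "(D i has_real_derivative D (Suc i) t) (at t)"
      unfolding D_def by (rule DERIV_diff)
  next
    fix t assume t: "t \<in> {a..b - s}"
    have "\<exists>z>t. z < t + s \<and> G j (t + s) - G j t = (t + s - t) * G (Suc j) z"
      using t \<open>s > 0\<close> by (intro MVT2 Suc.prems(2)) auto
    then obtain z where z: "t < z" "z < t + s" "D j t = s * G (Suc j) z"
      by (auto simp: D_def)
    have "l \<le> G (Suc j) z \<and> G (Suc j) z \<le> u" using z t by (intro Suc.prems(3)) auto
    then show "l * s \<le> D j t \<and> D j t \<le> u * s"
      using \<open>s > 0\<close> z by (simp add: mult.commute)
  qed (use Suc.prems in \<open>auto simp: algebra_simps\<close>)
  moreover have "fwd_diff (\<lambda>k. G 0 (t0 + real k * s)) = (\<lambda>k. D 0 (t0 + real k * s))"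
    by (auto simp: fwd_diff_def D_def algebra_simps)
  then have "(fwd_diff ^^ Suc j) (\<lambda>k. G 0 (t0 + real k * s)) = (fwd_diff ^^ j) (\<lambda>k. D 0 (t0 + real k * s))"
    by (simp only: funpow_Suc_right o_def)
  ultimately show ?case by (simp add: mult_ac)
qed

section \<open>Parametrised power series\<close>

text \<open>The one-variable shadow of joint analyticity. Continuity of the coefficients and the
  bound uniform in \<open>x\<close> are what joint continuity of all t-derivatives requires, and the
  class is closed under \<open>deriv\<close> in \<open>t\<close>. The same radius \<open>s\<close>
  serves \<open>x\<close> and \<open>t\<close>.\<close>

definition locally_powser :: "('a::metric_space \<Rightarrow> real \<Rightarrow> real) \<Rightarrow> 'a \<Rightarrow> real \<Rightarrow> bool" where
  "locally_powser g x0 t0 \<longleftrightarrow> (\<exists>s>0. \<exists>a B. (\<forall>k. continuous_on (cball x0 s) (a k)) \<and>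
     (\<forall>k. \<forall>x\<in>cball x0 s. \<bar>a k x\<bar> * s ^ k \<le> B) \<and>
     (\<forall>x\<in>cball x0 s. \<forall>t. \<bar>t - t0\<bar> < s \<longrightarrow> (\<lambda>k. a k x * (t - t0) ^ k) sums g x t))"

lemma powser_shift_has_derivative:
  fixes f :: "real \<Rightarrow> real"
  assumes sums: "\<And>t. \<bar>t - t0\<bar> < s \<Longrightarrow> (\<lambda>k. a k * (t - t0) ^ k) sums f t" and t: "\<bar>t - t0\<bar> < s"
  shows "(f has_real_derivative deriv f t) (at t)" "(\<lambda>k. diffs a k * (t - t0) ^ k) sums deriv f t"
proof -
  have summ: "summable (\<lambda>n. a n * z ^ n)" if "norm z < s" for z :: real
    using sums[of "t0 + z"] that by (auto simp: sums_iff)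
  have "((\<lambda>z. \<Sum>n. a n * z ^ n) has_real_derivative (\<Sum>n. diffs a n * (t - t0) ^ n)) (at (t - t0))"
    using t by (intro termdiffs_strong'[OF summ]) auto
  then have "((\<lambda>t. \<Sum>n. a n * (t - t0) ^ n) has_real_derivative (\<Sum>n. diffs a n * (t - t0) ^ n)) (at t)"
    using DERIV_shift[of "\<lambda>z. \<Sum>n. a n * z ^ n" "\<Sum>n. diffs a n * (t - t0) ^ n" t "- t0"] by simp
  then have der: "(f has_real_derivative (\<Sum>n. diffs a n * (t - t0) ^ n)) (at t)"
  proof (rule has_field_derivative_transform_within_open[where S = "ball t0 s"])
    show "(\<Sum>n. a n * (x - t0) ^ n) = f x" if "x \<in> ball t0 s" for x
      using sums[of x] that by (simp add: sums_iff dist_real_def abs_minus_commute)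
  qed (use t in \<open>auto simp: dist_real_def\<close>)
  then show "(f has_real_derivative deriv f t) (at t)"
    by (simp add: DERIV_imp_deriv)
  have "summable (\<lambda>n. diffs a n * (t - t0) ^ n)"
    using t by (intro termdiff_converges[OF _ summ]) auto
  then show "(\<lambda>k. diffs a k * (t - t0) ^ k) sums deriv f t"
    using der by (simp add: DERIV_imp_deriv sums_iff)
qed

lemma locally_powser_imp_has_deriv:
  assumes "locally_powser g x0 t0"
  shows "(g x0 has_real_derivative deriv (g x0) t0) (at t0)"
proof -
  obtain s a where "s > 0" and
    "\<forall>x\<in>cball x0 s. \<forall>t. \<bar>t - t0\<bar> < s \<longrightarrow> (\<lambda>k. a k x * (t - t0) ^ k) sums g x t"
    using assms unfolding locally_powser_def by blast
  then show ?thesis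
    by (intro powser_shift_has_derivative(1)[of t0 s "\<lambda>k. a k x0"]) auto
qed

text \<open>Halving the radius absorbs the factor k + 1 from termwise differentiation, because k + 1
  is at most 2 ^ k.\<close>

lemma locally_powser_deriv:
  assumes "locally_powser g x0 t0"
  shows "locally_powser (\<lambda>x. deriv (g x)) x0 t0"
proof -
  obtain s a B where s: "s > 0" and cont: "\<forall>k. continuous_on (cball x0 s) (a k)"
    and bound: "\<forall>k. \<forall>x\<in>cball x0 s. \<bar>a k x\<bar> * s ^ k \<le> B"
    and sums: "\<forall>x\<in>cball x0 s. \<forall>t. \<bar>t - t0\<bar> < s \<longrightarrow> (\<lambda>k. a k x * (t - t0) ^ k) sums g x t"
    using assms unfolding locally_powser_def by blast
  have sub: "cball x0 (s / 2) \<subseteq> cball x0 s" using s by auto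
  have "\<forall>k. continuous_on (cball x0 (s / 2)) (\<lambda>x. real (Suc k) * a (Suc k) x)"
    using cont continuous_on_subset[OF _ sub] by (auto intro!: continuous_intros)
  moreover have "\<forall>k. \<forall>x\<in>cball x0 (s / 2). \<bar>real (Suc k) * a (Suc k) x\<bar> * (s / 2) ^ k \<le> B / s"
  proof (intro allI ballI)
    fix k x assume x: "x \<in> cball x0 (s / 2)"
    have *: "Suc k \<le> 2 ^ k" by (induction k) auto
    have "real (Suc k) \<le> 2 ^ k" using of_nat_mono[OF *, where 'a = real] by simp
    then have q: "real (Suc k) / 2 ^ k \<le> 1" by simp
    have "\<bar>real (Suc k) * a (Suc k) x\<bar> * (s / 2) ^ k = (\<bar>a (Suc k) x\<bar> * s ^ Suc k / s) * (real (Suc k) / 2 ^ k)"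
      using s by (simp add: abs_mult power_divide del: of_nat_Suc)
    also have "\<dots> \<le> (\<bar>a (Suc k) x\<bar> * s ^ Suc k / s) * 1"
      using s q by (intro mult_left_mono) auto
    also have "\<dots> \<le> B / s"
      using s bound[rule_format, of x "Suc k"] x sub by (simp add: field_simps)
    finally show "\<bar>real (Suc k) * a (Suc k) x\<bar> * (s / 2) ^ k \<le> B / s" .
  qed
  moreover have "\<forall>x\<in>cball x0 (s / 2). \<forall>t. \<bar>t - t0\<bar> < s / 2 \<longrightarrow>
      (\<lambda>k. real (Suc k) * a (Suc k) x * (t - t0) ^ k) sums deriv (g x) t"
  proof (intro ballI allI impI)
    fix x t assume "x \<in> cball x0 (s / 2)" "\<bar>t - t0\<bar> < s / 2"
    then have "(\<lambda>k. diffs (\<lambda>k. a k x) k * (t - t0) ^ k) sums deriv (g x) t"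
      using sums s sub by (intro powser_shift_has_derivative(2)[where s = s]) auto
    then show "(\<lambda>k. real (Suc k) * a (Suc k) x * (t - t0) ^ k) sums deriv (g x) t"
      by (simp add: diffs_def)
  qed
  ultimately show ?thesis
    unfolding locally_powser_def using s
    by (intro exI[of _ "s / 2"] exI[of _ "\<lambda>k x. real (Suc k) * a (Suc k) x"] exI[of _ "B / s"] conjI) auto
qed

lemma locally_powser_funpow_deriv:
  assumes "locally_powser g x0 t0"
  shows "locally_powser (\<lambda>x. (deriv ^^ j) (g x)) x0 t0"
  using assms by (induction j) (auto dest: locally_powser_deriv)

text \<open>At half the radius the k-th term is at most B / 2 ^ k, so the series converges uniformly
  in both variables.\<close>

lemma locally_powser_imp_isCont:
  assumes "locally_powser g x0 t0"
  shows "isCont (\<lambda>(x, t). g x t) (x0, t0)"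
proof -
  obtain s a B where s: "s > 0" and cont: "\<forall>k. continuous_on (cball x0 s) (a k)"
    and bound: "\<forall>k. \<forall>x\<in>cball x0 s. \<bar>a k x\<bar> * s ^ k \<le> B"
    and sums: "\<forall>x\<in>cball x0 s. \<forall>t. \<bar>t - t0\<bar> < s \<longrightarrow> (\<lambda>k. a k x * (t - t0) ^ k) sums g x t"
    using assms unfolding locally_powser_def by blast
  define D where "D = ball x0 (s / 2) \<times> ball t0 (s / 2)"
  have D: "x \<in> cball x0 s" "\<bar>t - t0\<bar> < s / 2" if "(x, t) \<in> D" for x t
    using that s by (auto simp: D_def dist_real_def abs_minus_commute)
  have "uniform_limit D (\<lambda>n p. \<Sum>k<n. a k (fst p) * (snd p - t0) ^ k)
      (\<lambda>p. \<Sum>k. a k (fst p) * (snd p - t0) ^ k) sequentially"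
  proof (rule Weierstrass_m_test)
    show "norm (a k (fst p) * (snd p - t0) ^ k) \<le> B * (1 / 2) ^ k" if "p \<in> D" for k p
    proof -
      obtain x t where p: "p = (x, t)" by (cases p)
      have "norm (a k x * (t - t0) ^ k) = \<bar>a k x\<bar> * \<bar>t - t0\<bar> ^ k" by (simp add: abs_mult power_abs)
      also have "\<dots> \<le> \<bar>a k x\<bar> * (s / 2) ^ k"
        using D[of x t] that p by (intro mult_left_mono power_mono) auto
      also have "\<dots> = (\<bar>a k x\<bar> * s ^ k) * (1 / 2) ^ k" by (simp add: power_divide)
      also have "\<dots> \<le> B * (1 / 2) ^ k"
        using bound D[of x t] that p by (intro mult_right_mono) auto
      finally show ?thesis by (simp add: p)
    qed
    show "summable (\<lambda>k. B * (1 / 2) ^ k)" by (intro summable_mult summable_geometric) simp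
  qed
  moreover have "continuous_on D (\<lambda>p. \<Sum>k<n. a k (fst p) * (snd p - t0) ^ k)" for n
  proof (intro continuous_intros)
    show "continuous_on D (\<lambda>p. a k (fst p))" for k
      by (rule continuous_on_compose2[OF cont[rule_format, of k]])
         (auto intro!: continuous_intros dest: D)
  qed
  ultimately have "continuous_on D (\<lambda>p. \<Sum>k. a k (fst p) * (snd p - t0) ^ k)"
    by (intro uniform_limit_theorem) auto
  moreover have "(\<Sum>k. a k (fst p) * (snd p - t0) ^ k) = (case p of (x, t) \<Rightarrow> g x t)" if "p \<in> D" for p
  proof -
    obtain x t where p: "p = (x, t)" by (cases p)
    have "\<bar>t - t0\<bar> < s" using D(2)[of x t] that p s by simp
    then show ?thesis using sums D(1)[of x t] that p by (auto simp: sums_iff)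
  qed
  ultimately have "continuous_on D (\<lambda>(x, t). g x t)"
    by (simp cong: continuous_on_cong)
  moreover have "open D" "(x0, t0) \<in> D" unfolding D_def using s by (auto intro: open_Times)
  ultimately show ?thesis
    by (simp add: continuous_on_eq_continuous_at)
qed

section \<open>Zeros of analytic functions and of their derivatives\<close>

lemma locally_powser_zero_or_isolated:
  assumes "locally_powser g x0 t0"
  shows "(\<forall>\<^sub>F t in nhds t0. g x0 t = 0) \<or> (\<forall>\<^sub>F t in at t0. g x0 t \<noteq> 0)"
proof -
  obtain s a where s: "s > 0" and
    "\<forall>x\<in>cball x0 s. \<forall>t. \<bar>t - t0\<bar> < s \<longrightarrow> (\<lambda>k. a k x * (t - t0) ^ k) sums g x t"
    using assms unfolding locally_powser_def by blast
  then have sums: "(\<lambda>k. a k x0 * (t - t0) ^ k) sums g x0 t" if "\<bar>t - t0\<bar> < s" for t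
    using that by auto
  show ?thesis
  proof (cases "g x0 t0 = 0")
    case False
    have "isCont (g x0) t0"
      using locally_powser_imp_has_deriv[OF assms] by (rule DERIV_isCont)
    then have "\<forall>\<^sub>F t in at t0. g x0 t \<noteq> 0"
      using False unfolding isCont_def by (rule tendsto_imp_eventually_ne)
    then show ?thesis ..
  next
    case True
    show ?thesis
    proof (cases "\<forall>m>0. a m x0 = 0")
      case a0: True
      have g: "g x0 t = a 0 x0" if "\<bar>t - t0\<bar> < s" for t
      proof -
        have "(\<lambda>k. a k x0 * (t - t0) ^ k) sums (\<Sum>k\<in>{0}. a k x0 * (t - t0) ^ k)"
          by (rule sums_finite) (use a0 in auto)
        then show ?thesis using sums[OF that] sums_unique2 by fastforce
      qed
      then have "a 0 x0 = 0" using True s by force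
      then have "\<forall>\<^sub>F t in nhds t0. g x0 t = 0"
        unfolding eventually_nhds_metric using g s by (auto simp: dist_real_def)
      then show ?thesis ..
    next
      case False
      then obtain m where m: "m > 0" "a m x0 \<noteq> 0" by auto
      have "\<exists>d>0. \<forall>z\<in>cball t0 d - {t0}. g x0 z \<noteq> 0"
        by (rule powser_0_nonzero[of s t0 "\<lambda>k. a k x0" "g x0" m]) (use s sums True m in auto)
      then obtain d where "d > 0" "\<forall>z\<in>cball t0 d - {t0}. g x0 z \<noteq> 0" by auto
      then have "\<forall>\<^sub>F t in at t0. g x0 t \<noteq> 0"
        unfolding eventually_at by (intro exI[of _ d]) (auto simp: dist_commute)
      then show ?thesis ..
    qed
  qed
qed

text \<open>Identity theorem by connectedness. The two alternatives define open sets, disjoint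
  because the real line has no isolated points, so one of them misses the interval. If it is the
  first, zeros cannot accumulate, and compactness leaves finitely many.\<close>

lemma finite_zeros_or_locally_zero:
  fixes f :: "real \<Rightarrow> real"
  assumes "\<And>t. t \<in> {a..b} \<Longrightarrow> (\<forall>\<^sub>F s in nhds t. f s = 0) \<or> (\<forall>\<^sub>F s in at t. f s \<noteq> 0)"
  shows "finite {t \<in> {a..b}. f t = 0} \<or> (\<forall>t\<in>{a..b}. \<forall>\<^sub>F s in nhds t. f s = 0)"
proof -
  define U where "U = {t. \<forall>\<^sub>F s in nhds t. f s = 0}"
  define V where "V = {t. \<forall>\<^sub>F s in at t. f s \<noteq> 0}"
  have "open U"
  proof (subst open_subopen, intro ballI)
    fix t assume "t \<in> U"
    then obtain S where "open S" "t \<in> S" "\<forall>x\<in>S. f x = 0"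
      unfolding U_def eventually_nhds by auto
    then show "\<exists>T. open T \<and> t \<in> T \<and> T \<subseteq> U" unfolding U_def eventually_nhds by blast
  qed
  have "open V"
  proof (subst open_subopen, intro ballI)
    fix t assume "t \<in> V"
    then obtain S where S: "open S" "t \<in> S" "\<forall>x\<in>S. x \<noteq> t \<longrightarrow> f x \<noteq> 0"
      unfolding V_def eventually_at_topological by auto
    have "x \<in> V" if "x \<in> S" for x
    proof (cases "x = t")
      case False
      then have "open (S - {t})" "x \<in> S - {t}" using S that by auto
      then show ?thesis unfolding V_def eventually_at_topological using S by blast
    qed (use \<open>t \<in> V\<close> in simp)
    then show "\<exists>T. open T \<and> t \<in> T \<and> T \<subseteq> V" using S by blast
  qed
  have disj: "U \<inter> V = {}"
  proof (rule ccontr)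
    assume "U \<inter> V \<noteq> {}"
    then obtain t where "\<forall>\<^sub>F s in nhds t. f s = 0" "\<forall>\<^sub>F s in at t. f s \<noteq> 0"
      unfolding U_def V_def by auto
    then have "\<forall>\<^sub>F s in at t. f s = 0 \<and> f s \<noteq> 0"
      by (intro eventually_conj) (auto simp: eventually_at_filter elim: eventually_mono)
    then show False by (simp add: trivial_limit_at)
  qed
  have "U \<inter> {a..b} = {} \<or> V \<inter> {a..b} = {}"
  proof (rule connectedD[OF connected_Icc \<open>open U\<close> \<open>open V\<close>])
    show "{a..b} \<subseteq> U \<union> V" using assms unfolding U_def V_def by blast
  qed (use disj in auto)
  then show ?thesis
  proof
    assume "U \<inter> {a..b} = {}"
    then have "\<not> t islimpt {t. f t = 0}" if "t \<in> {a..b}" for t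
      using assms[OF that] that unfolding U_def islimpt_iff_eventually by auto
    then have "finite ({a..b} \<inter> {t. f t = 0})"
      by (intro finite_not_islimpt_in_compact) auto
    moreover have "{t \<in> {a..b}. f t = 0} = {a..b} \<inter> {t. f t = 0}" by auto
    ultimately show ?thesis by simp
  next
    assume "V \<inter> {a..b} = {}"
    then have "\<forall>t\<in>{a..b}. \<forall>\<^sub>F s in nhds t. f s = 0"
      using assms unfolding V_def by blast
    then show ?thesis ..
  qed
qed

lemma funpow_deriv_locally_zero:
  fixes f :: "real \<Rightarrow> real"
  assumes "\<forall>\<^sub>F s in nhds t. f s = 0"
  shows "\<forall>\<^sub>F s in nhds t. (deriv ^^ j) f s = 0"
  using assms
proof (induction j)
  case (Suc j)
  then obtain S where S: "open S" "t \<in> S" "\<forall>x\<in>S. (deriv ^^ j) f x = 0"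
    unfolding eventually_nhds by auto
  have "deriv ((deriv ^^ j) f) x = 0" if "x \<in> S" for x
  proof -
    have "((\<lambda>_. 0) has_real_derivative 0) (at x)" by simp
    then have "((deriv ^^ j) f has_real_derivative 0) (at x)"
      by (rule has_field_derivative_transform_within_open[OF _ S(1) that]) (use S in auto)
    then show ?thesis by (rule DERIV_imp_deriv)
  qed
  then show ?case unfolding eventually_nhds using S by auto
qed simp

text \<open>Infinitely many zeros of the i-th derivative would make it vanish near every point of
  the interval, and the j-th derivative with it. One nonvanishing order thus controls all lower
  ones.\<close>

lemma finite_zeros_lower_derivative:
  assumes powser: "\<And>t. t \<in> {a..b} \<Longrightarrow> locally_powser g x t"
    and nz: "\<exists>t\<in>{a..b}. (deriv ^^ j) (g x) t \<noteq> 0" and "i \<le> j"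
  shows "finite {t \<in> {a..b}. (deriv ^^ i) (g x) t = 0}"
proof (rule ccontr)
  assume inf: "\<not> ?thesis"
  have "\<forall>t\<in>{a..b}. \<forall>\<^sub>F s in nhds t. (deriv ^^ i) (g x) s = 0"
    using finite_zeros_or_locally_zero[of a b "(deriv ^^ i) (g x)"] inf
      locally_powser_zero_or_isolated[OF locally_powser_funpow_deriv[OF powser]] by blast
  then have "\<forall>\<^sub>F s in nhds t. (deriv ^^ (j - i)) ((deriv ^^ i) (g x)) s = 0" if "t \<in> {a..b}" for t
    using funpow_deriv_locally_zero that by blast
  then have zero: "(deriv ^^ (j - i)) ((deriv ^^ i) (g x)) t = 0" if "t \<in> {a..b}" for t
    using eventually_nhds_x_imp_x that by blast
  have "(deriv ^^ (j - i)) ((deriv ^^ i) (g x)) = (deriv ^^ j) (g x)"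
    using \<open>i \<le> j\<close> by (metis comp_apply funpow_add le_add_diff_inverse2)
  with zero have "(deriv ^^ j) (g x) t = 0" if "t \<in> {a..b}" for t
    using that by simp
  then show False using nz by blast
qed

text \<open>\<open>curve_deriv\<close> differentiates componentwise, and \<open>deriv\<close>
  commutes with linear combinations only where the components are differentiable. The open set
  \<open>T\<close> supplies two-sided derivatives even at the ends of [0, 1].\<close>

lemma inner_curve_deriv:
  fixes \<gamma> :: "real \<Rightarrow> real ^ 'd"
  assumes T: "open T"
    and diff: "\<And>j i t. t \<in> T \<Longrightarrow> ((deriv ^^ j) (\<lambda>s. \<gamma> s $ i) has_real_derivative (deriv ^^ Suc j) (\<lambda>s. \<gamma> s $ i) t) (at t)"
    and "t \<in> T"
  shows "h \<bullet> curve_deriv j \<gamma> t = (deriv ^^ j) (\<lambda>s. h \<bullet> \<gamma> s) t"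
proof -
  have "\<forall>t\<in>T. (deriv ^^ j) (\<lambda>s. h \<bullet> \<gamma> s) t = (\<Sum>i\<in>UNIV. h $ i * (deriv ^^ j) (\<lambda>s. \<gamma> s $ i) t)"
  proof (induction j)
    case 0
    then show ?case by (simp add: inner_vec_def)
  next
    case (Suc j)
    show ?case
    proof
      fix t assume t: "t \<in> T"
      have "((\<lambda>t. \<Sum>i\<in>UNIV. h $ i * (deriv ^^ j) (\<lambda>s. \<gamma> s $ i) t) has_real_derivative
          (\<Sum>i\<in>UNIV. h $ i * (deriv ^^ Suc j) (\<lambda>s. \<gamma> s $ i) t)) (at t)"
        by (intro DERIV_sum DERIV_cmult diff t)
      then have "((deriv ^^ j) (\<lambda>s. h \<bullet> \<gamma> s) has_real_derivative
          (\<Sum>i\<in>UNIV. h $ i * (deriv ^^ Suc j) (\<lambda>s. \<gamma> s $ i) t)) (at t)"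
        by (rule has_field_derivative_transform_within_open[OF _ T t]) (use Suc in auto)
      then show "(deriv ^^ Suc j) (\<lambda>s. h \<bullet> \<gamma> s) t = (\<Sum>i\<in>UNIV. h $ i * (deriv ^^ Suc j) (\<lambda>s. \<gamma> s $ i) t)"
        by (simp add: DERIV_imp_deriv)
    qed
  qed
  then show ?thesis using \<open>t \<in> T\<close> by (simp add: inner_vec_def curve_deriv_def)
qed

text \<open>Summing first over the exponents of \<open>x\<close> rewrites the multivariate expansion as a power series in
  \<open>t - t0\<close> with coefficients continuous in \<open>x\<close>. Evaluating at the corner \<open>(x0 + (s, \<dots>, s), t0 + s)\<close>
  gives the absolutely convergent majorant.\<close>

lemma real_analytic_family_imp_locally_powser:
  fixes \<phi> :: "real ^ 'm \<Rightarrow> real \<Rightarrow> real ^ 'd"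
  assumes "real_analytic_family_on \<phi> U" "(x0, t0) \<in> U"
  shows "locally_powser (\<lambda>x t. h \<bullet> \<phi> x t) x0 t0"
proof -
  obtain r and c :: "('m option \<Rightarrow> nat) \<Rightarrow> real ^ 'd" where r: "r > 0" and
    exp: "\<And>x t. dist (x, t) (x0, t0) < r \<Longrightarrow>
          ((\<lambda>\<alpha>. ((\<Prod>i\<in>UNIV. (x $ i - x0 $ i) ^ \<alpha> (Some i)) * (t - t0) ^ \<alpha> None) *\<^sub>R c \<alpha>)
             has_sum \<phi> x t) UNIV"
    using assms unfolding real_analytic_family_on_def by blast
  define d where "d k \<beta> = h \<bullet> c (case_option k \<beta>)" for k and \<beta> :: "'m \<Rightarrow> nat"
  define mon where "mon y \<beta> = (\<Prod>i\<in>UNIV. (y $ i) ^ \<beta> i)" for y :: "real ^ 'm" and \<beta> :: "'m \<Rightarrow> nat"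
  have exp2: "((\<lambda>(k, \<beta>). mon (x - x0) \<beta> * (t - t0) ^ k * d k \<beta>) has_sum h \<bullet> \<phi> x t) (UNIV \<times> UNIV)"
    if "dist (x, t) (x0, t0) < r" for x t
  proof -
    have "((\<lambda>\<alpha>. h \<bullet> (((\<Prod>i\<in>UNIV. (x $ i - x0 $ i) ^ \<alpha> (Some i)) * (t - t0) ^ \<alpha> None) *\<^sub>R c \<alpha>))
             has_sum h \<bullet> \<phi> x t) UNIV"
      by (rule has_sum_bounded_linear[OF bounded_linear_inner_right exp[OF that]])
    also have "?this \<longleftrightarrow> ?thesis"
    proof (rule has_sum_reindex_bij_witness[where i = "\<lambda>(k, \<beta>). case_option k \<beta>" and j = "\<lambda>\<alpha>. (\<alpha> None, \<lambda>i. \<alpha> (Some i))"])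
      fix \<alpha> :: "'m option \<Rightarrow> nat"
      have "case_option (\<alpha> None) (\<lambda>i. \<alpha> (Some i)) = \<alpha>"
        by (rule ext) (auto split: option.split)
      then show "(case (\<alpha> None, \<lambda>i. \<alpha> (Some i)) of (k, \<beta>) \<Rightarrow> case_option k \<beta>) = \<alpha>"
        and "(case (\<alpha> None, \<lambda>i. \<alpha> (Some i)) of (k, \<beta>) \<Rightarrow> mon (x - x0) \<beta> * (t - t0) ^ k * d k \<beta>) =
          h \<bullet> (((\<Prod>i\<in>UNIV. (x $ i - x0 $ i) ^ \<alpha> (Some i)) * (t - t0) ^ \<alpha> None) *\<^sub>R c \<alpha>)"
        by (simp_all add: d_def mon_def)
    qed auto
    finally show ?thesis .
  qed
  define e :: "real ^ 'm" where "e = (\<chi> i. 1)"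
  \<comment> \<open>Chosen to meet two demands: the corner at offset \<open>(s, ..., s)\<close> lies
    within distance \<open>r\<close>, and so does every point with both \<open>x\<close> and
    \<open>t\<close> within \<open>s\<close>, which uses 2 s < r.\<close>
  define s where "s = r / (2 * (2 + norm (e, 1::real)))"
  have pos: "2 + norm (e, 1::real) > 0" by (simp add: add_pos_nonneg)
  have s: "s > 0" unfolding s_def using r pos by simp
  have s_eq: "s * (2 + norm (e, 1::real)) = r / 2" unfolding s_def using pos by (simp add: divide_simps)
  have s_nn: "0 \<le> s * norm (e, 1::real)" using s by (intro mult_nonneg_nonneg) auto
  have "s * 2 + s * norm (e, 1::real) = r / 2" using s_eq by (simp only: distrib_left)
  then have s1: "s * norm (e, 1::real) < r" and s2: "2 * s < r"
    using s s_nn by linarith+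
  define M where "M = (\<lambda>(k, \<beta>). mon (s *\<^sub>R e) \<beta> * s ^ k * \<bar>d k \<beta>\<bar>)"
  have mon_pos: "mon (s *\<^sub>R e) \<beta> \<ge> 0" for \<beta>
    unfolding mon_def e_def using s by (auto intro!: prod_nonneg)
  have "dist (x0 + s *\<^sub>R e, t0 + s) (x0, t0) = norm (s *\<^sub>R (e, 1::real))"
    by (simp add: dist_norm)
  also have "\<dots> = s * norm (e, 1::real)"
    using s by (subst norm_scaleR) simp
  also have "\<dots> < r" by (rule s1)
  finally have "(\<lambda>(k, \<beta>). mon (s *\<^sub>R e) \<beta> * s ^ k * d k \<beta>) summable_on (UNIV \<times> UNIV)"
    using exp2[of "x0 + s *\<^sub>R e" "t0 + s"] by (auto simp: summable_on_def)
  \<comment> \<open>Pairing with \<open>h\<close> has made the terms real, and for real families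
    unconditional summability is absolute summability.\<close>
  then have "(\<lambda>p. norm ((\<lambda>(k, \<beta>). mon (s *\<^sub>R e) \<beta> * s ^ k * d k \<beta>) p)) summable_on (UNIV \<times> UNIV)"
    by (rule summable_on_iff_abs_summable_on_real[THEN iffD1])
  moreover have "(\<lambda>p. norm ((\<lambda>(k, \<beta>). mon (s *\<^sub>R e) \<beta> * s ^ k * d k \<beta>) p)) = M"
    using s mon_pos by (auto simp: M_def abs_mult fun_eq_iff)
  ultimately have M: "M summable_on (UNIV \<times> UNIV)" by simp
  have Mabs: "(\<lambda>p. norm (M p)) summable_on (UNIV \<times> UNIV)"
    using M by (rule summable_on_iff_abs_summable_on_real[THEN iffD1])
  have M0: "M p \<ge> 0" for p
    using s mon_pos by (auto simp: M_def split: prod.split)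
  have Mk: "(\<lambda>\<beta>. M (k, \<beta>)) summable_on UNIV" for k
    using Infinite_Sum.abs_summable_on_Sigma_iff[THEN iffD1, OF Mabs] M0 by simp
  have "(\<lambda>k. norm (\<Sum>\<^sub>\<infinity>\<beta>. M (k, \<beta>))) summable_on UNIV"
    using Infinite_Sum.abs_summable_on_Sigma_iff[THEN iffD1, OF Mabs] M0 by simp
  then have "(\<lambda>k. \<Sum>\<^sub>\<infinity>\<beta>. M (k, \<beta>)) summable_on UNIV"
    by (rule summable_on_iff_abs_summable_on_real[THEN iffD2])
  then have "summable (\<lambda>k. \<Sum>\<^sub>\<infinity>\<beta>. M (k, \<beta>))"
    by (rule summable_on_imp_summable)
  \<comment> \<open>The sums over \<open>\<beta>\<close> are the terms of a convergent series in
    \<open>k\<close>, hence bounded; this yields the uniform coefficient bound.\<close>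
  then obtain B where B: "\<And>k. norm (\<Sum>\<^sub>\<infinity>\<beta>. M (k, \<beta>)) \<le> B"
    using summable_imp_Bseq unfolding Bseq_def by metis
  have mon_le: "\<bar>mon (x - x0) \<beta>\<bar> \<le> mon (s *\<^sub>R e) \<beta>" if "x \<in> cball x0 s" for x \<beta>
  proof -
    have "\<bar>x $ i - x0 $ i\<bar> \<le> s" for i
      using component_le_norm_cart[of "x - x0" i] that by (simp add: dist_norm norm_minus_commute)
    then show ?thesis
      unfolding mon_def abs_prod e_def by (intro prod_mono) (auto simp: power_abs intro!: power_mono)
  qed
  have dom: "norm (mon (x - x0) \<beta> * d k \<beta>) \<le> M (k, \<beta>) / s ^ k" if "x \<in> cball x0 s" for x k \<beta>
  proof -
    have "norm (mon (x - x0) \<beta> * d k \<beta>) \<le> mon (s *\<^sub>R e) \<beta> * \<bar>d k \<beta>\<bar>"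
      using mon_le[OF that] by (simp add: abs_mult mult_right_mono)
    then show ?thesis using s by (simp add: M_def)
  qed
  have Mk': "(\<lambda>\<beta>. M (k, \<beta>) / s ^ k) summable_on UNIV" for k
    using summable_on_cmult_right[OF Mk[of k], of "1 / s ^ k"] by simp
  define a where "a k x = (\<Sum>\<^sub>\<infinity>\<beta>. mon (x - x0) \<beta> * d k \<beta>)" for k x
  have abs_summ: "(\<lambda>\<beta>. norm (mon (x - x0) \<beta> * d k \<beta>)) summable_on UNIV" if "x \<in> cball x0 s" for x k
    by (rule Infinite_Sum.abs_summable_on_comparison_test'[OF Mk'[of k]]) (use dom that in auto)
  have a_sum: "((\<lambda>\<beta>. mon (x - x0) \<beta> * d k \<beta>) has_sum a k x) UNIV" if "x \<in> cball x0 s" for x k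
    unfolding a_def using abs_summ[OF that] by (intro has_sum_infsum) (rule summable_on_iff_abs_summable_on_real[THEN iffD2])
  have cont: "continuous_on (cball x0 s) (a k)" for k
    unfolding a_def
  proof (rule uniform_limit_theorem)
    show "uniform_limit (cball x0 s) (\<lambda>X x. \<Sum>\<beta>\<in>X. mon (x - x0) \<beta> * d k \<beta>)
        (\<lambda>x. \<Sum>\<^sub>\<infinity>\<beta>. mon (x - x0) \<beta> * d k \<beta>) (finite_subsets_at_top UNIV)"
      by (rule Weierstrass_m_test_general[OF _ Mk'[of k]]) (rule dom)
    show "\<forall>\<^sub>F X in finite_subsets_at_top UNIV. continuous_on (cball x0 s) (\<lambda>x. \<Sum>\<beta>\<in>X. mon (x - x0) \<beta> * d k \<beta>)"
      unfolding mon_def by (intro always_eventually allI continuous_intros)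
  qed auto
  have bound: "\<bar>a k x\<bar> * s ^ k \<le> B" if x: "x \<in> cball x0 s" for k x
  proof -
    have "\<bar>a k x\<bar> \<le> (\<Sum>\<^sub>\<infinity>\<beta>. norm (mon (x - x0) \<beta> * d k \<beta>))"
      unfolding a_def using norm_infsum_bound[OF abs_summ[OF x, of k]] by simp
    also have "\<dots> \<le> (\<Sum>\<^sub>\<infinity>\<beta>. M (k, \<beta>) / s ^ k)"
      by (rule infsum_mono[OF abs_summ[OF x] Mk' dom[OF x]])
    also have "\<dots> = (\<Sum>\<^sub>\<infinity>\<beta>. M (k, \<beta>)) / s ^ k"
      using infsum_cmult_right'[of "1 / s ^ k" "\<lambda>\<beta>. M (k, \<beta>)" UNIV] by simp
    finally have "\<bar>a k x\<bar> * s ^ k \<le> (\<Sum>\<^sub>\<infinity>\<beta>. M (k, \<beta>))"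
      using s by (simp add: field_simps)
    then show ?thesis using B[of k] by simp
  qed
  have sums: "(\<lambda>k. a k x * (t - t0) ^ k) sums (h \<bullet> \<phi> x t)" if x: "x \<in> cball x0 s" and t: "\<bar>t - t0\<bar> < s" for x t
  proof (rule has_sum_imp_sums, rule has_sum_SigmaD)
    have "dist (x, t) (x0, t0) \<le> dist x x0 + dist t t0"
      by (simp add: dist_Pair_Pair sqrt_sum_squares_le_sum)
    also have "\<dots> < r" using x t s2 by (simp add: dist_real_def dist_commute)
    finally show "((\<lambda>(k, \<beta>). mon (x - x0) \<beta> * (t - t0) ^ k * d k \<beta>) has_sum h \<bullet> \<phi> x t) (UNIV \<times> UNIV)"
      by (rule exp2)
    show "((\<lambda>\<beta>. (\<lambda>(k, \<beta>). mon (x - x0) \<beta> * (t - t0) ^ k * d k \<beta>) (k, \<beta>)) has_sum a k x * (t - t0) ^ k) UNIV" for k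
      using has_sum_cmult_left[OF a_sum[OF x, of k], of "(t - t0) ^ k"] by (simp add: mult_ac)
  qed
  show ?thesis
    unfolding locally_powser_def using s cont bound sums by (intro exI[of _ s] conjI exI[of _ a] exI[of _ B]) auto
qed

section \<open>Weyl's criterion on the torus\<close>

lemma unit_cube_eq_cbox: "(unit_cube :: (real ^ 'm) set) = cbox 0 (\<chi> i. 1)"
  by (auto simp: unit_cube_def mem_box_cart)

lemma compact_unit_cube: "compact (unit_cube :: (real ^ 'm) set)"
  by (simp add: unit_cube_eq_cbox)

lemma measure_unit_cube: "measure lborel (unit_cube :: (real ^ 'm) set) = 1"
proof -
  have "cbox 0 (\<chi> i. 1) \<noteq> ({} :: (real ^ 'm) set)"
    by (auto simp: interval_ne_empty_cart)
  then show ?thesis by (simp add: unit_cube_eq_cbox content_cbox_cart)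
qed

lemma integral_cbox_shift:
  fixes f :: "'a::euclidean_space \<Rightarrow> 'b::banach"
  assumes "continuous_on UNIV f"
  shows "integral (cbox a b) (\<lambda>x. f (x + c)) = integral (cbox (a + c) (b + c)) f"
proof -
  have "(f has_integral integral (cbox (a + c) (b + c)) f) (cbox (a + c) (b + c))"
    using assms by (intro integrable_integral integrable_continuous) (auto intro: continuous_on_subset)
  then have "((\<lambda>x. f (x + c)) has_integral integral (cbox (a + c) (b + c)) f) (cbox a b)"
    using has_integral_shift_cbox_iff[of f c] by (simp add: o_def add.commute)
  then show ?thesis by (rule integral_unique)
qed

text \<open>The shifted cube is cut at the hyperplane where the i-th coordinate is 1, and the slab
  beyond it is moved back by one period; it fills exactly the slab that the shift had left
  uncovered.\<close>

lemma integral_unit_cube_shift: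
  fixes f :: "real ^ 'm \<Rightarrow> 'b::banach"
  assumes cont: "continuous_on UNIV f" and per: "\<And>x. f (x + axis i 1) = f x"
    and s: "0 \<le> s" "s \<le> 1"
  shows "integral unit_cube (\<lambda>x. f (x + s *\<^sub>R axis i 1)) = integral unit_cube f"
proof -
  define e :: "real ^ 'm" where "e = (\<chi> i. 1)"
  define k :: "real ^ 'm" where "k = axis i 1"
  have kB: "k \<in> Basis" by (simp add: k_def)
  have xk: "x \<bullet> k = x $ i" for x by (simp add: k_def inner_axis)
  have kj: "k $ j = (if j = i then 1 else 0)" for j by (simp add: k_def axis_def)
  have split: "integral (cbox a b) f = integral (cbox a b \<inter> {x. x \<bullet> k \<le> r}) f + integral (cbox a b \<inter> {x. x \<bullet> k \<ge> r}) f" for a b r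
  proof (rule integral_unique, rule has_integral_split[OF _ _ kB])
    have *: "f integrable_on cbox a b" for a b
      using cont by (intro integrable_continuous) (auto intro: continuous_on_subset)
    show "(f has_integral integral (cbox a b \<inter> {x. x \<bullet> k \<le> r}) f) (cbox a b \<inter> {x. x \<bullet> k \<le> r})"
      "(f has_integral integral (cbox a b \<inter> {x. x \<bullet> k \<ge> r}) f) (cbox a b \<inter> {x. x \<bullet> k \<ge> r})"
      using * kB by (auto intro!: integrable_integral simp: interval_split)
  qed
  have e1: "(cbox 0 e \<inter> {x. x \<bullet> k \<le> s}) = cbox 0 (e - (1 - s) *\<^sub>R k)"
  proof (rule set_eqI)
    fix x
    have "x \<in> (cbox 0 e \<inter> {x. x \<bullet> k \<le> s}) \<longleftrightarrow> (\<forall>j. 0 \<le> x $ j \<and> x $ j \<le> 1 \<and> (j = i \<longrightarrow> x $ j \<le> s))"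
      by (auto simp: mem_box_cart xk e_def)
    also have "\<dots> \<longleftrightarrow> (\<forall>j. 0 \<le> x $ j \<and> x $ j \<le> 1 - (1 - s) * k $ j)"
      by (intro iff_allI) (use s in \<open>auto simp: kj\<close>)
    also have "\<dots> \<longleftrightarrow> x \<in> cbox 0 (e - (1 - s) *\<^sub>R k)"
      by (auto simp: mem_box_cart xk e_def)
    finally show "x \<in> (cbox 0 e \<inter> {x. x \<bullet> k \<le> s}) \<longleftrightarrow> x \<in> cbox 0 (e - (1 - s) *\<^sub>R k)" .
  qed
  have e2: "(cbox 0 e \<inter> {x. x \<bullet> k \<ge> s}) = (cbox (s *\<^sub>R k) (e + s *\<^sub>R k) \<inter> {x. x \<bullet> k \<le> 1})"
  proof (rule set_eqI)
    fix x
    have "x \<in> (cbox 0 e \<inter> {x. x \<bullet> k \<ge> s}) \<longleftrightarrow> (\<forall>j. 0 \<le> x $ j \<and> x $ j \<le> 1 \<and> (j = i \<longrightarrow> s \<le> x $ j))"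
      by (auto simp: mem_box_cart xk e_def)
    also have "\<dots> \<longleftrightarrow> (\<forall>j. s * k $ j \<le> x $ j \<and> x $ j \<le> 1 + s * k $ j \<and> (j = i \<longrightarrow> x $ j \<le> 1))"
      by (intro iff_allI) (use s in \<open>auto simp: kj\<close>)
    also have "\<dots> \<longleftrightarrow> x \<in> (cbox (s *\<^sub>R k) (e + s *\<^sub>R k) \<inter> {x. x \<bullet> k \<le> 1})"
      by (auto simp: mem_box_cart xk e_def)
    finally show "x \<in> (cbox 0 e \<inter> {x. x \<bullet> k \<ge> s}) \<longleftrightarrow> x \<in> (cbox (s *\<^sub>R k) (e + s *\<^sub>R k) \<inter> {x. x \<bullet> k \<le> 1})" .
  qed
  have e3: "(cbox (s *\<^sub>R k) (e + s *\<^sub>R k) \<inter> {x. x \<bullet> k \<ge> 1}) = cbox (0 + k) ((e - (1 - s) *\<^sub>R k) + k)"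
  proof (rule set_eqI)
    fix x
    have "x \<in> (cbox (s *\<^sub>R k) (e + s *\<^sub>R k) \<inter> {x. x \<bullet> k \<ge> 1}) \<longleftrightarrow> (\<forall>j. s * k $ j \<le> x $ j \<and> x $ j \<le> 1 + s * k $ j \<and> (j = i \<longrightarrow> 1 \<le> x $ j))"
      by (auto simp: mem_box_cart xk e_def)
    also have "\<dots> \<longleftrightarrow> (\<forall>j. k $ j \<le> x $ j \<and> x $ j \<le> 1 - (1 - s) * k $ j + k $ j)"
      by (intro iff_allI) (use s in \<open>auto simp: kj\<close>)
    also have "\<dots> \<longleftrightarrow> x \<in> cbox (0 + k) ((e - (1 - s) *\<^sub>R k) + k)"
      by (auto simp: mem_box_cart xk e_def)
    finally show "x \<in> (cbox (s *\<^sub>R k) (e + s *\<^sub>R k) \<inter> {x. x \<bullet> k \<ge> 1}) \<longleftrightarrow> x \<in> cbox (0 + k) ((e - (1 - s) *\<^sub>R k) + k)" .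
  qed
  have "integral unit_cube (\<lambda>x. f (x + s *\<^sub>R k)) = integral (cbox (s *\<^sub>R k) (e + s *\<^sub>R k)) f"
    unfolding unit_cube_eq_cbox using integral_cbox_shift[OF cont, of 0 e "s *\<^sub>R k"] by (simp add: e_def)
  also have "\<dots> = integral (cbox 0 e \<inter> {x. x \<bullet> k \<ge> s}) f + integral (cbox (0 + k) ((e - (1 - s) *\<^sub>R k) + k)) f"
    unfolding split[of "s *\<^sub>R k" "e + s *\<^sub>R k" 1] e2 e3 ..
  also have "integral (cbox (0 + k) ((e - (1 - s) *\<^sub>R k) + k)) f = integral (cbox 0 (e - (1 - s) *\<^sub>R k)) f"
    using integral_cbox_shift[OF cont, of 0 "e - (1 - s) *\<^sub>R k" k] per by (simp add: k_def)
  also have "integral (cbox 0 e \<inter> {x. x \<bullet> k \<ge> s}) f + integral (cbox 0 (e - (1 - s) *\<^sub>R k)) f = integral (cbox 0 e) f"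
    unfolding split[of 0 e s] e1 by (rule add.commute)
  finally show ?thesis unfolding unit_cube_eq_cbox k_def e_def .
qed

section \<open>Characters and trigonometric polynomials\<close>

lemma continuous_on_character: "continuous_on S (\<lambda>x :: real ^ 'd. cis (2 * pi * (h \<bullet> x)))"
  by (intro continuous_intros)

text \<open>Translating by 1 / (2 |h_i|) along an axis with h_i nonzero multiplies the character by
  -1, while periodicity preserves the integral, so the integral equals its negative. Integrality
  gives |h_i| at least 1, hence a translation length at most 1.\<close>

lemma integral_character_eq_0:
  fixes h :: "real ^ 'd"
  assumes h: "int_vec h" "h \<noteq> 0"
  shows "integral unit_cube (\<lambda>x. cis (2 * pi * (h \<bullet> x))) = 0"
proof -
  define u where "u x = cis (2 * pi * (h \<bullet> x))" for x
  obtain i where i: "h $ i \<noteq> 0" using h by (auto simp: vec_eq_iff)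
  have hi: "h $ i \<in> \<int>" using h by (simp add: int_vec_def)
  define s where "s = 1 / (2 * \<bar>h $ i\<bar>)"
  have "\<bar>h $ i\<bar> \<ge> 1" using hi i by (rule Ints_nonzero_abs_ge1)
  then have s: "0 \<le> s" "s \<le> 1" by (auto simp: s_def divide_simps)
  have shift: "u (x + r *\<^sub>R axis i 1) = u x * cis (2 * pi * (h $ i * r))" for x r
    by (simp add: u_def inner_add_right inner_axis cis_mult algebra_simps)
  have "h $ i * s = 1 / 2 \<or> h $ i * s = - (1 / 2)"
    using i by (auto simp: s_def abs_if)
  then have "cis (2 * pi * (h $ i * s)) = -1"
    by (elim disjE) (simp_all only:, simp_all add: complex_eq_iff)
  then have "integral unit_cube (\<lambda>x. u (x + s *\<^sub>R axis i 1)) = - integral unit_cube u"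
    unfolding shift by simp
  moreover have "integral unit_cube (\<lambda>x. u (x + s *\<^sub>R axis i 1)) = integral unit_cube u"
  proof (rule integral_unit_cube_shift)
    show "continuous_on UNIV u" unfolding u_def by (rule continuous_on_character)
    show "u (x + axis i 1) = u x" for x
      using shift[of x 1] cis_multiple_2pi[OF hi] by simp
  qed (use s in auto)
  ultimately have "integral unit_cube u = 0" by simp
  then show ?thesis unfolding u_def .
qed

text \<open>Products are derived rather than built in: convergence of averages is additive but not
  multiplicative, so induction over characters and sums is what the limit argument can use.\<close>

inductive trig_poly :: "(real ^ 'd \<Rightarrow> complex) \<Rightarrow> bool" where
  character: "int_vec h \<Longrightarrow> trig_poly (\<lambda>x. c * cis (2 * pi * (h \<bullet> x)))"
| add: "trig_poly u \<Longrightarrow> trig_poly v \<Longrightarrow> trig_poly (\<lambda>x. u x + v x)"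

lemma trig_poly_const: "trig_poly (\<lambda>x. c)"
  using trig_poly.character[of 0 c] by (simp add: int_vec_def)

lemma trig_poly_mult:
  assumes "trig_poly u" "trig_poly v"
  shows "trig_poly (\<lambda>x. u x * v x)"
  using assms
proof (induction u rule: trig_poly.induct)
  case (character h c)
  from character.prems show ?case
  proof (induction v rule: trig_poly.induct)
    case (character h' c')
    have "int_vec (h + h')" using \<open>int_vec h\<close> character by (simp add: int_vec_def)
    then have "trig_poly (\<lambda>x. (c * c') * cis (2 * pi * ((h + h') \<bullet> x)))" by (rule trig_poly.character)
    moreover have "(c * c') * cis (2 * pi * ((h + h') \<bullet> x)) = c * cis (2 * pi * (h \<bullet> x)) * (c' * cis (2 * pi * (h' \<bullet> x)))" for x
      by (simp add: inner_add_left ring_distribs cis_mult[symmetric])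
    ultimately show ?case by simp
  next
    case (add u v)
    then show ?case by (simp add: ring_distribs trig_poly.add)
  qed
next
  case (add u v)
  then show ?case by (simp add: ring_distribs trig_poly.add)
qed

lemma trig_poly_sum:
  assumes "finite A" "\<And>i. i \<in> A \<Longrightarrow> trig_poly (u i)"
  shows "trig_poly (\<lambda>x. \<Sum>i\<in>A. u i x)"
  using assms by (induction A rule: finite_induct) (auto intro: trig_poly.add trig_poly_const)

text \<open>Realises the quotient torus as a compact subset of a Euclidean space, where the
  Stone-Weierstrass theorem for real polynomials is available.\<close>

definition torus_embedding :: "real ^ 'd \<Rightarrow> complex ^ 'd" where
  "torus_embedding x = (\<chi> i. cis (2 * pi * x $ i))"

lemma trig_poly_torus_component:
  fixes i :: "'d::finite"
  shows "trig_poly (\<lambda>x :: real ^ 'd. complex_of_real (Re (torus_embedding x $ i)))"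
    and "trig_poly (\<lambda>x :: real ^ 'd. complex_of_real (Im (torus_embedding x $ i)))"
proof -
  have int: "int_vec (axis i 1 :: real ^ 'd)" "int_vec (- axis i 1 :: real ^ 'd)"
    by (auto simp: int_vec_def axis_def)
  have "trig_poly (\<lambda>x :: real ^ 'd. 1 / 2 * cis (2 * pi * (axis i 1 \<bullet> x)) + 1 / 2 * cis (2 * pi * ((- axis i 1) \<bullet> x)))"
    by (intro trig_poly.intros int)
  moreover have "1 / 2 * cis (2 * pi * (axis i 1 \<bullet> x)) + 1 / 2 * cis (2 * pi * ((- axis i 1) \<bullet> x)) =
      complex_of_real (Re (torus_embedding x $ i))" for x :: "real ^ 'd"
    by (simp add: torus_embedding_def inner_axis' complex_eq_iff)
  ultimately show "trig_poly (\<lambda>x :: real ^ 'd. complex_of_real (Re (torus_embedding x $ i)))" by simp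
  have "trig_poly (\<lambda>x :: real ^ 'd. - \<i> / 2 * cis (2 * pi * (axis i 1 \<bullet> x)) + \<i> / 2 * cis (2 * pi * ((- axis i 1) \<bullet> x)))"
    by (intro trig_poly.intros int)
  moreover have "- \<i> / 2 * cis (2 * pi * (axis i 1 \<bullet> x)) + \<i> / 2 * cis (2 * pi * ((- axis i 1) \<bullet> x)) =
      complex_of_real (Im (torus_embedding x $ i))" for x :: "real ^ 'd"
    by (simp add: torus_embedding_def inner_axis' complex_eq_iff)
  ultimately show "trig_poly (\<lambda>x :: real ^ 'd. complex_of_real (Im (torus_embedding x $ i)))" by simp
qed

lemma trig_poly_polynomial_torus:
  fixes p :: "complex ^ 'd \<Rightarrow> real"
  assumes "real_polynomial_function p"
  shows "trig_poly (\<lambda>x. complex_of_real (p (torus_embedding x)))"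
  using assms
proof (induction p rule: real_polynomial_function.induct)
  case (linear f)
  interpret bounded_linear f by fact
  \<comment> \<open>\<open>f\<close> is linear over the reals only, so its values on
    \<open>axis i 1\<close> and \<open>axis i \<i>\<close> enter as independent
    coefficients.\<close>
  have fy: "f y = (\<Sum>i\<in>UNIV. f (axis i 1) * Re (y $ i) + f (axis i \<i>) * Im (y $ i))" for y
  proof -
    have "axis i (y $ i) = Re (y $ i) *\<^sub>R axis i 1 + Im (y $ i) *\<^sub>R axis i \<i>" for i
      by (auto simp: vec_eq_iff axis_def complex_eq_iff)
    then have "f (axis i (y $ i)) = f (axis i 1) * Re (y $ i) + f (axis i \<i>) * Im (y $ i)" for i
      by (simp add: add scaleR mult.commute)
    moreover have "y = (\<Sum>i\<in>UNIV. axis i (y $ i))"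
      by (simp add: vec_eq_iff axis_def)
    ultimately show ?thesis using sum[of "\<lambda>i. axis i (y $ i)" UNIV] by simp
  qed
  have "complex_of_real (f (torus_embedding x)) = (\<Sum>i\<in>UNIV. complex_of_real (f (axis i 1)) * complex_of_real (Re (torus_embedding x $ i))
      + complex_of_real (f (axis i \<i>)) * complex_of_real (Im (torus_embedding x $ i)))" for x
    by (subst fy) simp
  moreover have "trig_poly (\<lambda>x. \<Sum>i\<in>UNIV. complex_of_real (f (axis i 1)) * complex_of_real (Re (torus_embedding x $ i))
      + complex_of_real (f (axis i \<i>)) * complex_of_real (Im (torus_embedding x $ i)))"
    by (intro trig_poly_sum trig_poly.add trig_poly_mult trig_poly_const trig_poly_torus_component) auto
  ultimately show ?case by simp
next
  case (const c)
  then show ?case by (rule trig_poly_const)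
next
  case (add f g)
  then show ?case by (simp add: trig_poly.add)
next
  case (mult f g)
  then show ?case by (simp add: trig_poly_mult)
qed

lemma torus_embedding_eq_iff: "torus_embedding x = torus_embedding y \<longleftrightarrow> int_vec (x - y)"
proof -
  have "cis (2 * pi * a) = cis (2 * pi * b) \<longleftrightarrow> a - b \<in> \<int>" for a b :: real
  proof
    assume "cis (2 * pi * a) = cis (2 * pi * b)"
    then have "sin (2 * pi * a) = sin (2 * pi * b) \<and> cos (2 * pi * a) = cos (2 * pi * b)"
      by (simp add: complex_eq_iff)
    then obtain n :: int where "2 * pi * a = 2 * pi * b + 2 * pi * n"
      unfolding sin_cos_eq_iff by blast
    then have "2 * pi * (a - b) = 2 * pi * n" by (simp add: algebra_simps)
    then show "a - b \<in> \<int>" by simp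
  next
    assume "a - b \<in> \<int>"
    have "cis (2 * pi * a) = cis (2 * pi * b) * cis (2 * pi * (a - b))"
      by (simp add: cis_mult algebra_simps)
    then show "cis (2 * pi * a) = cis (2 * pi * b)"
      using cis_multiple_2pi[OF \<open>a - b \<in> \<int>\<close>] by simp
  qed
  then show ?thesis by (simp add: torus_embedding_def int_vec_def vec_eq_iff)
qed

text \<open>A periodic \<open>f\<close> descends to a continuous function on the embedded torus; a
  polynomial approximating it there pulls back to a trigonometric polynomial.\<close>

lemma trig_poly_approx:
  fixes f :: "real ^ 'd \<Rightarrow> real"
  assumes cont: "continuous_on UNIV f" and per: "\<And>x h. int_vec h \<Longrightarrow> f (x + h) = f x" and "\<epsilon> > 0"
  shows "\<exists>u. trig_poly u \<and> (\<forall>x. norm (complex_of_real (f x) - u x) < \<epsilon>)"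
proof -
  define S where "S = torus_embedding ` (unit_cube :: (real ^ 'd) set)"
  \<comment> \<open>The choice is harmless: two preimages of the same point differ by an integer
    vector, and \<open>f\<close> is periodic.\<close>
  define F where "F y = f (SOME x. torus_embedding x = y)" for y
  have F: "F (torus_embedding x) = f x" for x
  proof -
    have "torus_embedding (SOME x'. torus_embedding x' = torus_embedding x) = torus_embedding x"
      by (rule someI) (rule refl)
    then have "int_vec ((SOME x'. torus_embedding x' = torus_embedding x) - x)"
      by (simp add: torus_embedding_eq_iff)
    from per[OF this, of x] show ?thesis unfolding F_def by simp
  qed
  have in_S: "torus_embedding x \<in> S" for x :: "real ^ 'd"
  proof -
    define y where "y = (\<chi> i. frac (x $ i))"
    have "y \<in> unit_cube" by (simp add: y_def unit_cube_def frac_ge_0 frac_lt_1 less_imp_le)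
    moreover have "torus_embedding x = torus_embedding y"
      by (simp add: torus_embedding_eq_iff int_vec_def y_def frac_def)
    ultimately show ?thesis unfolding S_def by blast
  qed
  have emb: "continuous_on A torus_embedding" for A :: "(real ^ 'd) set"
    unfolding torus_embedding_def by (intro continuous_intros)
  have "compact S" unfolding S_def by (intro compact_continuous_image emb compact_unit_cube)
  moreover have "continuous_on S F"
  \<comment> \<open>Quotient-map argument: the preimage of a closed set under \<open>F\<close> is
    the image of a compact part of the unit cube, hence closed.\<close>
  proof (subst continuous_on_closed_vimage)
    show "closed S" using \<open>compact S\<close> by (rule compact_imp_closed)
    show "\<forall>B. closed B \<longrightarrow> closed (F -` B \<inter> S)"
    proof (intro allI impI)
      fix B :: "real set" assume "closed B"
      have "closed (f -` B)" using cont \<open>closed B\<close> by (simp add: continuous_closed_vimage continuous_on_eq_continuous_at)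
      then have "compact (unit_cube \<inter> f -` B)" by (intro compact_Int_closed compact_unit_cube)
      then have "compact (torus_embedding ` (unit_cube \<inter> f -` B))"
        by (intro compact_continuous_image emb)
      moreover have "torus_embedding ` (unit_cube \<inter> f -` B) = F -` B \<inter> S"
        unfolding S_def by (auto simp: F)
      ultimately show "closed (F -` B \<inter> S)" using compact_imp_closed by metis
    qed
  qed
  ultimately obtain p where p: "real_polynomial_function p" "\<And>y. y \<in> S \<Longrightarrow> \<bar>F y - p y\<bar> < \<epsilon>"
    using Stone_Weierstrass_real_polynomial_function[OF _ _ \<open>\<epsilon> > 0\<close>] by blast
  have "norm (complex_of_real (f x) - complex_of_real (p (torus_embedding x))) < \<epsilon>" for x
    using p(2)[OF in_S[of x]] F[of x] by (metis norm_of_real of_real_diff)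
  then show ?thesis using trig_poly_polynomial_torus[OF p(1)] by blast
qed

lemma trig_poly_continuous: "trig_poly u \<Longrightarrow> continuous_on S u"
  by (induction u rule: trig_poly.induct) (auto intro!: continuous_intros continuous_on_character)

lemma continuous_integrable_on_unit_cube:
  fixes f :: "real ^ 'd \<Rightarrow> 'b::banach"
  assumes "continuous_on UNIV f"
  shows "f integrable_on unit_cube"
  unfolding unit_cube_eq_cbox using assms
  by (intro integrable_continuous) (auto intro: continuous_on_subset)

lemma trig_poly_average_tendsto:
  fixes y :: "nat \<Rightarrow> nat \<Rightarrow> real ^ 'd"
  assumes char: "\<And>h. int_vec h \<Longrightarrow> h \<noteq> 0 \<Longrightarrow> (\<lambda>n. (1 / of_nat n) * (\<Sum>k = 1..n. cis (2 * pi * (h \<bullet> y n k)))) \<longlonglongrightarrow> 0"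
    and "trig_poly u"
  shows "(\<lambda>n. (1 / of_nat n) * (\<Sum>k = 1..n. u (y n k))) \<longlonglongrightarrow> integral unit_cube u"
  using assms(2)
proof (induction u rule: trig_poly.induct)
  case (character h c)
  show ?case
  proof (cases "h = 0")
    case True
    \<comment> \<open>The average of the constant is \<open>c\<close> only from n = 1 on; at n = 0
      division by zero makes it 0.\<close>
    have ev: "\<forall>\<^sub>F n in sequentially. c = (1 / of_nat n) * (\<Sum>k = 1..n. c * cis (2 * pi * (h \<bullet> y n k)))"
      using eventually_ge_at_top[of 1] by eventually_elim (simp add: True)
    have "integral unit_cube (\<lambda>x. c * cis (2 * pi * (h \<bullet> x))) = c"
      using measure_unit_cube[where 'm = 'd] by (simp add: True unit_cube_eq_cbox)
    then show ?thesis using Lim_transform_eventually[OF tendsto_const ev] by (simp only:)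
  next
    case False
    have "(\<lambda>n. c * ((1 / of_nat n) * (\<Sum>k = 1..n. cis (2 * pi * (h \<bullet> y n k))))) \<longlonglongrightarrow> c * 0"
      by (intro tendsto_mult_left char character False)
    then have "(\<lambda>n. (1 / of_nat n) * (\<Sum>k = 1..n. c * cis (2 * pi * (h \<bullet> y n k)))) \<longlonglongrightarrow> c * 0"
      by (simp add: sum_distrib_left mult_ac)
    moreover have "integral unit_cube (\<lambda>x. c * cis (2 * pi * (h \<bullet> x))) = c * 0"
      by (simp add: integral_character_eq_0[OF character False])
    ultimately show ?thesis by (simp only:)
  qed
next
  case (add u v)
  have "integral unit_cube (\<lambda>x. u x + v x) = integral unit_cube u + integral unit_cube v"
    by (intro Henstock_Kurzweil_Integration.integral_add continuous_integrable_on_unit_cube trig_poly_continuous add)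
  then show ?case using tendsto_add[OF add.IH] by (simp add: sum.distrib ring_distribs)
qed

text \<open>A three-epsilon argument: neither averaging nor integrating over a cube of measure 1
  enlarges the uniform error of the approximating trigonometric polynomial.\<close>

lemma Weyl_criterion:
  fixes y :: "nat \<Rightarrow> nat \<Rightarrow> real ^ 'd" and f :: "real ^ 'd \<Rightarrow> real"
  assumes char: "\<And>h. int_vec h \<Longrightarrow> h \<noteq> 0 \<Longrightarrow> (\<lambda>n. (1 / of_nat n) * (\<Sum>k = 1..n. cis (2 * pi * (h \<bullet> y n k)))) \<longlonglongrightarrow> 0"
    and cont: "continuous_on UNIV f" and per: "\<And>x h. int_vec h \<Longrightarrow> f (x + h) = f x"
  shows "(\<lambda>n. (1 / real n) * (\<Sum>k = 1..n. f (y n k))) \<longlonglongrightarrow> integral unit_cube f"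
proof (rule tendstoI)
  fix \<epsilon> :: real assume \<epsilon>: "\<epsilon> > 0"
  obtain u where u: "trig_poly u" and fu: "\<And>x. norm (complex_of_real (f x) - u x) < \<epsilon> / 3"
    using trig_poly_approx[OF cont per, of "\<epsilon> / 3"] \<epsilon> by auto
  have "\<forall>\<^sub>F n in sequentially. dist ((1 / of_nat n) * (\<Sum>k = 1..n. u (y n k))) (integral unit_cube u) < \<epsilon> / 3"
    using trig_poly_average_tendsto[OF char u] \<epsilon> by (intro tendstoD) auto
  then show "\<forall>\<^sub>F n in sequentially. dist ((1 / real n) * (\<Sum>k = 1..n. f (y n k))) (integral unit_cube f) < \<epsilon>"
    using eventually_ge_at_top[of 1]
  proof eventually_elim
    case (elim n)
    define A where "A = (1 / of_nat n) * (\<Sum>k = 1..n. complex_of_real (f (y n k)))"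
    define Au where "Au = (1 / of_nat n) * (\<Sum>k = 1..n. u (y n k))"
    define I where "I = complex_of_real (integral unit_cube f)"
    define Iu where "Iu = integral unit_cube u"
    have "A - Au = (1 / of_nat n) * (\<Sum>k = 1..n. complex_of_real (f (y n k)) - u (y n k))"
      by (simp add: A_def Au_def sum_subtractf right_diff_distrib)
    then have "norm (A - Au) = (1 / real n) * norm (\<Sum>k = 1..n. complex_of_real (f (y n k)) - u (y n k))"
      by (simp add: norm_mult norm_divide)
    also have "\<dots> \<le> (1 / real n) * (\<Sum>k = 1..n. \<epsilon> / 3)"
      using fu by (intro mult_left_mono sum_norm_le) (auto intro: less_imp_le)
    also have "\<dots> = \<epsilon> / 3" using elim by simp
    finally have 1: "norm (A - Au) \<le> \<epsilon> / 3" .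
    have 2: "norm (Au - Iu) < \<epsilon> / 3" using elim by (simp add: Au_def Iu_def dist_norm)
    have "((\<lambda>x. complex_of_real (f x)) has_integral I) unit_cube"
      unfolding I_def using has_integral_linear[OF integrable_integral[OF continuous_integrable_on_unit_cube[OF cont]] bounded_linear_of_real]
      by (simp add: o_def)
    then have "((\<lambda>x. u x - complex_of_real (f x)) has_integral (Iu - I)) unit_cube"
      unfolding Iu_def
      by (intro has_integral_diff integrable_integral continuous_integrable_on_unit_cube trig_poly_continuous u)
    then have "norm (Iu - I) \<le> \<epsilon> / 3 * measure lborel (unit_cube :: (real ^ 'd) set)"
      unfolding unit_cube_eq_cbox using fu \<epsilon>
      by (intro has_integral_bound[where f = "\<lambda>x. u x - complex_of_real (f x)"]) (auto simp: norm_minus_commute intro: less_imp_le)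
    then have 3: "norm (Iu - I) \<le> \<epsilon> / 3" by (simp add: measure_unit_cube)
    have "norm (A - I) \<le> norm (A - Au) + norm (Au - Iu) + norm (Iu - I)"
      using norm_triangle_ineq[of "A - Au" "Au - I"] norm_triangle_ineq[of "Au - Iu" "Iu - I"] by simp
    also have "\<dots> < \<epsilon>" using 1 2 3 by linarith
    finally have "norm (A - I) < \<epsilon>" .
    moreover have "A - I = complex_of_real ((1 / real n) * (\<Sum>k = 1..n. f (y n k)) - integral unit_cube f)"
      by (simp add: A_def I_def)
    ultimately show ?case by (metis dist_real_def norm_of_real)
  qed
qed

section \<open>Exponential sums along analytic families\<close>

text \<open>The intermediate value theorem fixes the sign along \<open>x0\<close>, compactness gives
  a positive minimum there, and uniform continuity preserves half of it for nearby
  \<open>x\<close>.\<close>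

lemma uniform_sign_near:
  fixes G :: "'a::metric_space \<Rightarrow> real \<Rightarrow> real"
  assumes cont: "continuous_on (X \<times> {a..b}) (\<lambda>(x, t). G x t)" and X: "compact X" "x0 \<in> X"
    and ab: "a \<le> b" and nz: "\<And>t. t \<in> {a..b} \<Longrightarrow> G x0 t \<noteq> 0"
  shows "\<exists>\<sigma>\<in>{-1, 1}. \<exists>c>0. \<exists>\<eta>>0. \<forall>x\<in>X. dist x x0 < \<eta> \<longrightarrow> (\<forall>t\<in>{a..b}. c \<le> \<sigma> * G x t)"
proof -
  have cont0: "continuous_on {a..b} (G x0)"
  proof -
    have "continuous_on {a..b} (\<lambda>t. case (x0, t) of (x, t) \<Rightarrow> G x t)"
      by (rule continuous_on_compose2[OF cont], intro continuous_intros) (use X in auto)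
    then show ?thesis by simp
  qed
  define \<sigma> :: real where "\<sigma> = (if G x0 a > 0 then 1 else -1)"
  have sign: "\<sigma> * G x0 t > 0" if t: "t \<in> {a..b}" for t
  proof (rule ccontr)
    assume neg: "\<not> \<sigma> * G x0 t > 0"
    have "\<sigma> * G x0 a > 0" using nz[of a] ab by (auto simp: \<sigma>_def)
    have "continuous_on {a..t} (\<lambda>t. \<sigma> * G x0 t)"
      using t by (intro continuous_intros continuous_on_subset[OF cont0]) auto
    then have "\<exists>z\<ge>a. z \<le> t \<and> \<sigma> * G x0 z = 0"
      using t neg \<open>\<sigma> * G x0 a > 0\<close> by (intro IVT2') auto
    then obtain z where "a \<le> z" "z \<le> t" "\<sigma> * G x0 z = 0" by blast
    then show False using nz[of z] t by (auto simp: \<sigma>_def split: if_splits)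
  qed
  have "\<exists>t1\<in>{a..b}. \<forall>t\<in>{a..b}. \<sigma> * G x0 t1 \<le> \<sigma> * G x0 t"
    using ab by (intro continuous_attains_inf continuous_intros cont0) auto
  then obtain t1 where t1: "t1 \<in> {a..b}" "\<And>t. t \<in> {a..b} \<Longrightarrow> \<sigma> * G x0 t1 \<le> \<sigma> * G x0 t" by blast
  define c where "c = \<sigma> * G x0 t1 / 2"
  have c: "c > 0" using sign[OF t1(1)] by (simp add: c_def)
  have "uniformly_continuous_on (X \<times> {a..b}) (\<lambda>(x, t). G x t)"
    using X by (intro compact_uniformly_continuous cont compact_Times) auto
  then obtain \<eta> where \<eta>: "\<eta> > 0" and close: "\<And>p q. p \<in> X \<times> {a..b} \<Longrightarrow> q \<in> X \<times> {a..b} \<Longrightarrow> dist q p < \<eta> \<Longrightarrow>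
      dist (case q of (x, t) \<Rightarrow> G x t) (case p of (x, t) \<Rightarrow> G x t) < c"
    unfolding uniformly_continuous_on_def using c by meson
  have "c \<le> \<sigma> * G x t" if x: "x \<in> X" "dist x x0 < \<eta>" and t: "t \<in> {a..b}" for x t
  proof -
    have "\<bar>G x t - G x0 t\<bar> < c"
      using close[of "(x0, t)" "(x, t)"] x t X by (simp add: dist_Pair_Pair dist_real_def)
    then have "\<bar>\<sigma> * G x t - \<sigma> * G x0 t\<bar> < c"
      by (auto simp: \<sigma>_def)
    then show ?thesis using t1(2)[OF t] unfolding c_def by linarith
  qed
  moreover have "\<sigma> \<in> {-1, 1}" by (simp add: \<sigma>_def)
  ultimately show ?thesis using c \<eta> by blast
qed

text \<open>The situation after passing to a subsequence. The number of samples \<open>N\<close> and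
  the amplitude \<open>\<rho>\<close> are separate functions of the index, since the index only
  enumerates that subsequence.\<close>

locale analytic_phase =
  fixes g :: "'a::metric_space \<Rightarrow> real \<Rightarrow> real" and X :: "'a set" and K :: nat
    and x0 :: 'a and L :: "'i filter" and xs :: "'i \<Rightarrow> 'a" and N :: "'i \<Rightarrow> nat" and \<rho> :: "'i \<Rightarrow> real"
  assumes X: "compact X" "x0 \<in> X"
    and powser: "\<And>x t. x \<in> X \<Longrightarrow> t \<in> {0..1} \<Longrightarrow> locally_powser g x t"
    and K: "K \<ge> 1"
    and x_in: "\<forall>\<^sub>F n in L. xs n \<in> X" and x_lim: "(xs \<longlongrightarrow> x0) L"
    and N_lim: "filterlim N at_top L" and \<rho>_lim: "filterlim \<rho> at_top L"
    and \<rho>_small: "((\<lambda>n. \<rho> n / real (N n) ^ K) \<longlongrightarrow> 0) L"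
begin

lemma continuous_on_derivs: "continuous_on (X \<times> {0..1}) (\<lambda>(x, t). (deriv ^^ j) (g x) t)"
  using locally_powser_imp_isCont[OF locally_powser_funpow_deriv[OF powser]]
  by (intro continuous_at_imp_continuous_on) auto

lemma has_deriv_derivs:
  "x \<in> X \<Longrightarrow> t \<in> {0..1} \<Longrightarrow> ((deriv ^^ j) (g x) has_real_derivative (deriv ^^ Suc j) (g x) t) (at t)"
  using locally_powser_imp_has_deriv[OF locally_powser_funpow_deriv[OF powser]] by simp

lemma derivs_bounded: "\<exists>C>0. \<forall>j\<le>M. \<forall>x\<in>X. \<forall>t\<in>{0..1}. \<bar>(deriv ^^ j) (g x) t\<bar> \<le> C"
proof -
  have "\<exists>C>0. \<forall>x\<in>X. \<forall>t\<in>{0..1}. \<bar>(deriv ^^ j) (g x) t\<bar> \<le> C" for j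
  proof -
    have "bounded ((\<lambda>(x, t). (deriv ^^ j) (g x) t) ` (X \<times> {0..1}))"
      by (intro compact_imp_bounded compact_continuous_image continuous_on_derivs compact_Times X) auto
    then show ?thesis unfolding bounded_pos by fastforce
  qed
  then obtain C where C: "\<And>j. C j > 0" "\<And>j x t. x \<in> X \<Longrightarrow> t \<in> {0..1} \<Longrightarrow> \<bar>(deriv ^^ j) (g x) t\<bar> \<le> C j"
    by metis
  have "C j \<le> (\<Sum>i\<le>M. C i)" if "j \<le> M" for j
    using that C(1) by (intro member_le_sum) (auto intro: less_imp_le)
  then show ?thesis using C(2) C(1)
    by (intro exI[of _ "\<Sum>i\<le>M. C i"]) (fastforce intro!: sum_pos intro: order_trans)
qed

lemma derivs_signs:
  assumes ab: "a \<le> b" "{a..b} \<subseteq> {0..1}"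
    and nz: "\<And>j t. j \<in> {1..K} \<Longrightarrow> t \<in> {a..b} \<Longrightarrow> (deriv ^^ j) (g x0) t \<noteq> 0"
  shows "\<exists>c>0. \<exists>\<eta>>0. \<forall>j\<in>{1..K}. \<exists>\<sigma>\<in>{-1, 1}. \<forall>x\<in>X. dist x x0 < \<eta> \<longrightarrow> (\<forall>t\<in>{a..b}. c \<le> \<sigma> * (deriv ^^ j) (g x) t)"
proof -
  have "\<forall>j\<in>{1..K}. \<exists>c>0. \<exists>\<eta>>0. \<exists>\<sigma>\<in>{-1, 1}. \<forall>x\<in>X. dist x x0 < \<eta> \<longrightarrow> (\<forall>t\<in>{a..b}. c \<le> \<sigma> * (deriv ^^ j) (g x) t)"
  proof
    fix j assume j: "j \<in> {1..K}"
    have "continuous_on (X \<times> {a..b}) (\<lambda>(x, t). (deriv ^^ j) (g x) t)"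
      using ab by (intro continuous_on_subset[OF continuous_on_derivs]) auto
    from uniform_sign_near[OF this X ab(1)] nz[OF j]
    show "\<exists>c>0. \<exists>\<eta>>0. \<exists>\<sigma>\<in>{-1, 1}. \<forall>x\<in>X. dist x x0 < \<eta> \<longrightarrow> (\<forall>t\<in>{a..b}. c \<le> \<sigma> * (deriv ^^ j) (g x) t)"
      by blast
  qed
  then obtain c where "\<forall>j\<in>{1..K}. c j > 0 \<and> (\<exists>\<eta>>0. \<exists>\<sigma>\<in>{-1, 1}. \<forall>x\<in>X. dist x x0 < \<eta> \<longrightarrow> (\<forall>t\<in>{a..b}. c j \<le> \<sigma> * (deriv ^^ j) (g x) t))"
    by metis
  then obtain \<eta> where c\<eta>: "\<forall>j\<in>{1..K}. c j > 0 \<and> \<eta> j > 0 \<and> (\<exists>\<sigma>\<in>{-1, 1}. \<forall>x\<in>X. dist x x0 < \<eta> j \<longrightarrow> (\<forall>t\<in>{a..b}. c j \<le> \<sigma> * (deriv ^^ j) (g x) t))"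
    by metis
  have ne: "finite (c ` {1..K})" "c ` {1..K} \<noteq> {}" "finite (\<eta> ` {1..K})" "\<eta> ` {1..K} \<noteq> {}" using K by auto
  have "Min (c ` {1..K}) > 0" "Min (\<eta> ` {1..K}) > 0" using c\<eta> ne by (simp_all add: Min_gr_iff)
  moreover have "\<forall>j\<in>{1..K}. \<exists>\<sigma>\<in>{-1, 1}. \<forall>x\<in>X. dist x x0 < Min (\<eta> ` {1..K}) \<longrightarrow> (\<forall>t\<in>{a..b}. Min (c ` {1..K}) \<le> \<sigma> * (deriv ^^ j) (g x) t)"
  proof
    fix j assume j: "j \<in> {1..K}"
    then obtain \<sigma> where \<sigma>: "\<sigma> \<in> {-1, 1}" "\<forall>x\<in>X. dist x x0 < \<eta> j \<longrightarrow> (\<forall>t\<in>{a..b}. c j \<le> \<sigma> * (deriv ^^ j) (g x) t)"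
      using c\<eta> by blast
    have "Min (c ` {1..K}) \<le> c j" "Min (\<eta> ` {1..K}) \<le> \<eta> j" using j ne by (auto intro!: Min_le)
    then show "\<exists>\<sigma>\<in>{-1, 1}. \<forall>x\<in>X. dist x x0 < Min (\<eta> ` {1..K}) \<longrightarrow> (\<forall>t\<in>{a..b}. Min (c ` {1..K}) \<le> \<sigma> * (deriv ^^ j) (g x) t)"
      using \<sigma> by (meson order_trans order_less_le_trans)
  qed
  ultimately show ?thesis by blast
qed

text \<open>Samples with index from \<open>Suc p\<close> to \<open>q\<close> lie in
  \<open>{a..b}\<close>, and the step 1 / n turns bounds on the j-th derivative into bounds on j-th
  differences with a factor n ^ (-j).\<close>

lemma sample_bounds_phase:
  assumes x: "x \<in> X" and ab: "{a..b} \<subseteq> {0..1}" and n: "n > 0" and r: "r \<ge> 0"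
    and lower: "\<forall>j\<in>{1..K}. \<exists>\<sigma>\<in>{-1, 1}. \<forall>t\<in>{a..b}. c \<le> \<sigma> * (deriv ^^ j) (g x) t"
    and upper: "\<forall>j\<le>Suc K. \<forall>t\<in>{0..1}. \<bar>(deriv ^^ j) (g x) t\<bar> \<le> C"
    and p: "a * real n \<le> real (Suc p)" and q: "real q \<le> b * real n"
  shows "sample_bounds K c C r n (q - p) (\<lambda>k. r * g x (real (Suc p + k) / real n))"
proof -
  define G where "G i t = r * (deriv ^^ i) (g x) t" for i t
  define t0 where "t0 = real (Suc p) / real n"
  have F: "(\<lambda>k. r * g x (real (Suc p + k) / real n)) = (\<lambda>k. G 0 (t0 + real k * (1 / real n)))"
    by (simp add: G_def t0_def add_divide_distrib add.assoc)
  have bounds: "l / real n ^ j \<le> (fwd_diff ^^ j) (\<lambda>k. G 0 (t0 + real k * (1 / real n))) k \<and>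
      (fwd_diff ^^ j) (\<lambda>k. G 0 (t0 + real k * (1 / real n))) k \<le> u / real n ^ j"
    if k: "k + j < q - p" and lu: "\<And>t. t \<in> {a..b} \<Longrightarrow> l \<le> G j t \<and> G j t \<le> u" for j k l u
  proof -
    have "l * (1 / real n) ^ j \<le> (fwd_diff ^^ j) (\<lambda>k. G 0 (t0 + real k * (1 / real n))) k \<and>
      (fwd_diff ^^ j) (\<lambda>k. G 0 (t0 + real k * (1 / real n))) k \<le> u * (1 / real n) ^ j"
    proof (rule fwd_diff_funpow_bounds[where a = a and b = b])
      show "(G i has_real_derivative G (Suc i) t) (at t)" if "t \<in> {a..b}" for i t
        unfolding G_def using that x ab by (intro DERIV_cmult has_deriv_derivs) auto
      show "a \<le> t0 + real k * (1 / real n)"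
        using p n by (simp add: t0_def field_simps)
      have "real (Suc p + (k + j)) \<le> real q" using k by linarith
      then have "real (Suc p + (k + j)) \<le> b * real n" using q by linarith
      then have "real (Suc p + (k + j)) / real n \<le> b"
        using n by (simp add: pos_divide_le_eq)
      then show "t0 + real (k + j) * (1 / real n) \<le> b"
        by (simp add: t0_def add_divide_distrib add.assoc)
    qed (use n lu in auto)
    then show ?thesis by (simp add: power_divide)
  qed
  have absG: "\<bar>G j t\<bar> \<le> C * r" if "j \<le> Suc K" "t \<in> {a..b}" for j t
  proof -
    have "\<bar>(deriv ^^ j) (g x) t\<bar> \<le> C" using upper ab that by blast
    from mult_right_mono[OF this r] show ?thesis using r by (simp add: G_def abs_mult mult.commute)
  qed
  show ?thesis
    unfolding sample_bounds_def F
  proof (intro conjI ballI allI impI)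
    fix j assume j: "j \<in> {1..K}"
    then obtain \<sigma> where \<sigma>: "\<sigma> \<in> {-1, 1}" and low: "\<forall>t\<in>{a..b}. c \<le> \<sigma> * (deriv ^^ j) (g x) t"
      using lower by blast
    have G\<sigma>: "c * r \<le> \<sigma> * G j t \<and> \<sigma> * G j t \<le> C * r" if t: "t \<in> {a..b}" for t
    proof
      have "c * r \<le> (\<sigma> * (deriv ^^ j) (g x) t) * r" using low t r by (intro mult_right_mono) auto
      then show "c * r \<le> \<sigma> * G j t" by (simp add: G_def mult_ac)
      show "\<sigma> * G j t \<le> C * r" using absG[of j t] j t \<sigma> by auto
    qed
    have "c * r / real n ^ j \<le> \<sigma> * (fwd_diff ^^ j) (\<lambda>k. G 0 (t0 + real k * (1 / real n))) k \<and>
        \<sigma> * (fwd_diff ^^ j) (\<lambda>k. G 0 (t0 + real k * (1 / real n))) k \<le> C * r / real n ^ j"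
      if k: "k + j < q - p" for k
    proof (cases "\<sigma> = 1")
      case True
      then show ?thesis using bounds[OF k, of "c * r" "C * r"] G\<sigma> by simp
    next
      case False
      then have "\<sigma> = -1" using \<sigma> by simp
      then have "- (C * r) \<le> G j t \<and> G j t \<le> - (c * r)" if "t \<in> {a..b}" for t
        using G\<sigma>[OF that] by auto
      from bounds[OF k this] show ?thesis using \<open>\<sigma> = -1\<close> by auto
    qed
    then show "\<exists>\<sigma>\<in>{-1, 1}. \<forall>k. k + j < q - p \<longrightarrow>
        c * r / real n ^ j \<le> \<sigma> * (fwd_diff ^^ j) (\<lambda>k. G 0 (t0 + real k * (1 / real n))) k \<and>
        \<sigma> * (fwd_diff ^^ j) (\<lambda>k. G 0 (t0 + real k * (1 / real n))) k \<le> C * r / real n ^ j"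
      using \<sigma> by blast
  next
    fix k assume k: "k + Suc K < q - p"
    have "- (C * r) / real n ^ Suc K \<le> (fwd_diff ^^ Suc K) (\<lambda>k. G 0 (t0 + real k * (1 / real n))) k \<and>
      (fwd_diff ^^ Suc K) (\<lambda>k. G 0 (t0 + real k * (1 / real n))) k \<le> C * r / real n ^ Suc K"
    proof (rule bounds[OF k])
      show "- (C * r) \<le> G (Suc K) t \<and> G (Suc K) t \<le> C * r" if "t \<in> {a..b}" for t
        using absG[OF _ that, of "Suc K"] by auto
    qed
    then show "\<bar>(fwd_diff ^^ Suc K) (\<lambda>k. G 0 (t0 + real k * (1 / real n))) k\<bar> \<le> C * r / real n ^ Suc K"
      unfolding abs_le_iff minus_divide_left[symmetric] by linarith
  qed
qed

text \<open>Uniformity in \<open>p\<close> and \<open>q\<close> matters because the cell ends,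
  measured in units of 1 / N n, are rounded to integers that vary with \<open>n\<close>.\<close>

lemma block_sum_small:
  assumes ab: "a \<le> b" "{a..b} \<subseteq> {0..1}"
    and nz: "\<And>j t. j \<in> {1..K} \<Longrightarrow> t \<in> {a..b} \<Longrightarrow> (deriv ^^ j) (g x0) t \<noteq> 0"
    and \<epsilon>: "\<epsilon> > 0"
  shows "\<forall>\<^sub>F n in L. \<forall>p q. a * real (N n) \<le> real (Suc p) \<longrightarrow> real q \<le> b * real (N n) \<longrightarrow>
    norm (\<Sum>k\<in>{p<..q}. cis (\<rho> n * g (xs n) (real k / real (N n)))) \<le> \<epsilon> * real (N n)"
proof -
  obtain c \<eta> where c: "c > 0" and \<eta>: "\<eta> > 0" and
    signs: "\<forall>j\<in>{1..K}. \<exists>\<sigma>\<in>{-1, 1}. \<forall>x\<in>X. dist x x0 < \<eta> \<longrightarrow> (\<forall>t\<in>{a..b}. c \<le> \<sigma> * (deriv ^^ j) (g x) t)"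
    using derivs_signs[OF ab nz] by blast
  obtain C where C: "C > 0" and upper: "\<forall>j\<le>Suc K. \<forall>x\<in>X. \<forall>t\<in>{0..1}. \<bar>(deriv ^^ j) (g x) t\<bar> \<le> C"
    using derivs_bounded by blast
  obtain R \<delta> n0 where R: "R > 0" and \<delta>: "\<delta> > 0" and small: "\<forall>n\<ge>n0. \<forall>M\<le>n. \<forall>r F. R \<le> r \<longrightarrow> r \<le> \<delta> * real n ^ K \<longrightarrow>
    sample_bounds K c C r n M F \<longrightarrow> norm (\<Sum>k<M. cis (F k)) \<le> \<epsilon> * real n"
    using exp_sum_small[OF K c C \<epsilon>] by (elim exE conjE)
  have "\<forall>\<^sub>F n in L. dist (xs n) x0 < \<eta>" using x_lim \<eta> by (rule tendstoD)
  moreover have "\<forall>\<^sub>F n in L. max n0 1 \<le> N n" using N_lim unfolding filterlim_at_top by blast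
  moreover have "\<forall>\<^sub>F n in L. R \<le> \<rho> n" using \<rho>_lim by (simp add: filterlim_at_top)
  moreover have "\<forall>\<^sub>F n in L. \<rho> n / real (N n) ^ K < \<delta>" using \<rho>_small \<delta> by (rule order_tendstoD)
  ultimately show ?thesis using x_in
  proof eventually_elim
    case (elim n)
    have Npos: "N n > 0" "N n \<ge> n0" using elim by auto
    have \<rho>_le: "\<rho> n \<le> \<delta> * real (N n) ^ K" using elim Npos by (simp add: field_simps)
    show ?case
    proof (intro allI impI)
      fix p q assume p: "a * real (N n) \<le> real (Suc p)" and q: "real q \<le> b * real (N n)"
      have "b \<le> 1" using ab by auto
      then have "b * real (N n) \<le> real (N n)" using mult_right_mono[of b 1 "real (N n)"] by simp
      then have qN: "q - p \<le> N n" using q by linarith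
      have lower: "\<forall>j\<in>{1..K}. \<exists>\<sigma>\<in>{-1, 1}. \<forall>t\<in>{a..b}. c \<le> \<sigma> * (deriv ^^ j) (g (xs n)) t"
        using signs elim by meson
      have "sample_bounds K c C (\<rho> n) (N n) (q - p) (\<lambda>k. \<rho> n * g (xs n) (real (Suc p + k) / real (N n)))"
        using elim upper Npos R p q by (intro sample_bounds_phase[OF _ ab(2) _ _ lower]) auto
      then have "norm (\<Sum>k<q - p. cis (\<rho> n * g (xs n) (real (Suc p + k) / real (N n)))) \<le> \<epsilon> * real (N n)"
        using small[rule_format, OF Npos(2) qN _ \<rho>_le] elim by blast
      moreover have "(\<Sum>k<q - p. cis (\<rho> n * g (xs n) (real (Suc p + k) / real (N n)))) =
          (\<Sum>k\<in>{p<..q}. cis (\<rho> n * g (xs n) (real k / real (N n))))"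
        by (intro sum.reindex_bij_witness[where i = "\<lambda>k. k - Suc p" and j = "\<lambda>k. Suc p + k"]) auto
      ultimately show "norm (\<Sum>k\<in>{p<..q}. cis (\<rho> n * g (xs n) (real k / real (N n)))) \<le> \<epsilon> * real (N n)"
        by simp
    qed
  qed
qed

end

section \<open>Assembling the cells\<close>

lemma sum_consecutive_blocks:
  fixes f :: "nat \<Rightarrow> 'a::comm_monoid_add"
  assumes "\<And>i. e i \<le> e (Suc i)"
  shows "(\<Sum>i<Q. \<Sum>k\<in>{e i<..e (Suc i)}. f k) = (\<Sum>k\<in>{e 0<..e Q}. f k)"
proof (induction Q)
  case (Suc Q)
  have "e 0 \<le> e Q" using lift_Suc_mono_le[of e, OF assms] by simp
  then have "{e 0<..e (Suc Q)} = {e 0<..e Q} \<union> {e Q<..e (Suc Q)}" using assms[of Q] by auto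
  then have "(\<Sum>k\<in>{e 0<..e (Suc Q)}. f k) = (\<Sum>k\<in>{e 0<..e Q}. f k) + (\<Sum>k\<in>{e Q<..e (Suc Q)}. f k)"
    by (simp only:) (rule sum.union_disjoint, auto)
  then show ?case using Suc by simp
qed simp

text \<open>Closed cells share their endpoints, so a point can lie in two of them; rounding z Q down
  gives the index of one candidate and its predecessor the other.\<close>

lemma card_cells_meeting_finite:
  fixes Z :: "real set"
  assumes "finite Z" "Q > 0"
  shows "card {i \<in> {..<Q}. \<exists>z\<in>Z. z \<in> {real i / real Q..real (Suc i) / real Q}} \<le> 2 * card Z"
proof -
  have "{i \<in> {..<Q}. \<exists>z\<in>Z. z \<in> {real i / real Q..real (Suc i) / real Q}} \<subseteq>
      (\<Union>z\<in>Z. {nat \<lfloor>z * real Q\<rfloor>, nat \<lfloor>z * real Q\<rfloor> - 1})"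
  proof
    fix i assume "i \<in> {i \<in> {..<Q}. \<exists>z\<in>Z. z \<in> {real i / real Q..real (Suc i) / real Q}}"
    then obtain z where z: "z \<in> Z" "real i / real Q \<le> z" "z \<le> real (Suc i) / real Q" by auto
    then have "real i \<le> z * real Q" "z * real Q \<le> real i + 1"
      using \<open>Q > 0\<close> by (simp_all add: field_simps)
    then have "i = nat \<lfloor>z * real Q\<rfloor> \<or> i = nat \<lfloor>z * real Q\<rfloor> - 1" by linarith
    then show "i \<in> (\<Union>z\<in>Z. {nat \<lfloor>z * real Q\<rfloor>, nat \<lfloor>z * real Q\<rfloor> - 1})" using z by blast
  qed
  then have "card {i \<in> {..<Q}. \<exists>z\<in>Z. z \<in> {real i / real Q..real (Suc i) / real Q}} \<le>
      card (\<Union>z\<in>Z. {nat \<lfloor>z * real Q\<rfloor>, nat \<lfloor>z * real Q\<rfloor> - 1})"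
    using assms by (intro card_mono) auto
  also have "\<dots> \<le> (\<Sum>z\<in>Z. card {nat \<lfloor>z * real Q\<rfloor>, nat \<lfloor>z * real Q\<rfloor> - 1})"
    by (rule card_UN_le[OF assms(1)])
  also have "\<dots> \<le> (\<Sum>z\<in>Z. 2)" by (intro sum_mono) (simp add: card_insert_if)
  finally show ?thesis by simp
qed

context analytic_phase
begin

lemma exp_sum_eventually_small:
  assumes fin: "\<And>j. j \<in> {1..K} \<Longrightarrow> finite {t \<in> {0..1}. (deriv ^^ j) (g x0) t = 0}" and \<epsilon>: "\<epsilon> > 0"
  shows "\<forall>\<^sub>F n in L. norm (\<Sum>k = 1..N n. cis (\<rho> n * g (xs n) (real k / real (N n)))) \<le> \<epsilon> * real (N n)"
proof -
  define Z where "Z = (\<Union>j\<in>{1..K}. {t \<in> {0..1}. (deriv ^^ j) (g x0) t = 0})"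
  have Z: "finite Z" unfolding Z_def using fin by auto
  \<comment> \<open>A bad cell costs at most N / Q + 1. This \<open>Q\<close> makes the N / Q parts
    of the at most 2 |Z| bad cells total \<epsilon> N / 4, and \<open>m\<close> below does the same
    for the rounding terms 1. The good cells share the remaining \<epsilon> N / 2.\<close>
  define Q where "Q = nat \<lceil>8 * real (card Z) / \<epsilon>\<rceil> + 1"
  have "Q > 0" by (simp add: Q_def)
  have "real Q \<ge> 8 * real (card Z) / \<epsilon>" unfolding Q_def by linarith
  then have ZQ: "2 * real (card Z) / real Q \<le> \<epsilon> / 4" using \<epsilon> \<open>Q > 0\<close> by (simp add: field_simps)
  define bad where "bad = {i \<in> {..<Q}. \<exists>z\<in>Z. z \<in> {real i / real Q..real (Suc i) / real Q}}"
  have bad: "card bad \<le> 2 * card Z" "bad \<subseteq> {..<Q}"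
    unfolding bad_def using card_cells_meeting_finite[OF Z \<open>Q > 0\<close>] by auto
  have cell: "{real i / real Q..real (Suc i) / real Q} \<subseteq> {0..1}" if "i < Q" for i
  proof -
    have "real (Suc i) / real Q \<le> 1" using that by simp
    then show ?thesis by (auto intro: order_trans[rotated])
  qed
  have "\<forall>i\<in>{..<Q} - bad. \<forall>\<^sub>F n in L. \<forall>p q. real i / real Q * real (N n) \<le> real (Suc p) \<longrightarrow>
      real q \<le> real (Suc i) / real Q * real (N n) \<longrightarrow>
      norm (\<Sum>k\<in>{p<..q}. cis (\<rho> n * g (xs n) (real k / real (N n)))) \<le> \<epsilon> / (2 * real Q) * real (N n)"
  proof
    fix i assume i: "i \<in> {..<Q} - bad"
    have "(deriv ^^ j) (g x0) t \<noteq> 0" if "j \<in> {1..K}" "t \<in> {real i / real Q..real (Suc i) / real Q}" for j t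
      using i that cell[of i] unfolding bad_def Z_def by blast
    then show "\<forall>\<^sub>F n in L. \<forall>p q. real i / real Q * real (N n) \<le> real (Suc p) \<longrightarrow>
      real q \<le> real (Suc i) / real Q * real (N n) \<longrightarrow>
      norm (\<Sum>k\<in>{p<..q}. cis (\<rho> n * g (xs n) (real k / real (N n)))) \<le> \<epsilon> / (2 * real Q) * real (N n)"
      using i \<epsilon> \<open>Q > 0\<close> cell[of i] by (intro block_sum_small) (auto simp: divide_right_mono)
  qed
  then have good: "\<forall>\<^sub>F n in L. \<forall>i\<in>{..<Q} - bad. \<forall>p q. real i / real Q * real (N n) \<le> real (Suc p) \<longrightarrow>
      real q \<le> real (Suc i) / real Q * real (N n) \<longrightarrow>
      norm (\<Sum>k\<in>{p<..q}. cis (\<rho> n * g (xs n) (real k / real (N n)))) \<le> \<epsilon> / (2 * real Q) * real (N n)"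
    by (intro eventually_ball_finite) auto
  define m where "m = nat \<lceil>8 * real (card Z) / \<epsilon>\<rceil>"
  have "\<forall>\<^sub>F n in L. m \<le> N n" using N_lim by (simp add: filterlim_at_top)
  with good show ?thesis
  proof eventually_elim
    case (elim n)
    \<comment> \<open>Rounding down places the indices of the half-open block from
      \<open>e i\<close> to \<open>e (Suc i)\<close> inside the i-th cell: the first is
      \<open>Suc (e i)\<close>, at least i N / Q.\<close>
    define e where "e i = i * N n div Q" for i
    define S where "S i = (\<Sum>k\<in>{e i<..e (Suc i)}. cis (\<rho> n * g (xs n) (real k / real (N n))))" for i
    have e_le: "real (e i) \<le> real i * real (N n) / real Q" for i
      unfolding e_def using of_nat_div_le_of_nat[of "i * N n" Q, where 'a = real] by simp
    have e_ge: "real i * real (N n) / real Q \<le> real (Suc (e i))" for i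
    proof -
      have "i * N n < Suc (e i) * Q" unfolding e_def
        using \<open>Q > 0\<close> by (metis dividend_less_div_times mult_Suc add.commute)
      then have "real i * real (N n) \<le> real (Suc (e i)) * real Q"
        by (metis less_imp_le of_nat_le_iff of_nat_mult)
      then show ?thesis using \<open>Q > 0\<close> by (simp add: field_simps)
    qed
    have "real (N n) \<ge> 8 * real (card Z) / \<epsilon>" using elim(2) unfolding m_def by linarith
    then have mN: "2 * real (card Z) \<le> \<epsilon> / 4 * real (N n)" using \<epsilon> by (simp add: field_simps)
    have good_i: "norm (S i) \<le> \<epsilon> / (2 * real Q) * real (N n)" if "i \<in> {..<Q} - bad" for i
      unfolding S_def using elim(1) that e_ge[of i] e_le[of "Suc i"] by simp
    have bad_i: "norm (S i) \<le> real (N n) / real Q + 1" for i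
    proof -
      have "norm (S i) \<le> (\<Sum>k\<in>{e i<..e (Suc i)}. 1)"
        unfolding S_def by (rule order_trans[OF norm_sum]) simp
      also have "\<dots> = real (e (Suc i) - e i)" by simp
      also have "\<dots> \<le> real (Suc i) * real (N n) / real Q - (real i * real (N n) / real Q - 1)"
      proof (cases "e i \<le> e (Suc i)")
        case True
        then show ?thesis using e_ge[of i] e_le[of "Suc i"] by (simp add: of_nat_diff)
      next
        case False
        then have "e (Suc i) - e i = 0" by simp
        moreover have "0 \<le> real (N n) / real Q" by simp
        ultimately show ?thesis by (simp add: ring_distribs add_divide_distrib)
      qed
      also have "\<dots> = real (N n) / real Q + 1" by (simp add: ring_distribs add_divide_distrib)
      finally show ?thesis .
    qed
    have "(\<Sum>k = 1..N n. cis (\<rho> n * g (xs n) (real k / real (N n)))) = (\<Sum>k\<in>{e 0<..e Q}. cis (\<rho> n * g (xs n) (real k / real (N n))))"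
      unfolding e_def using \<open>Q > 0\<close> by (intro sum.cong) auto
    also have "\<dots> = (\<Sum>i<Q. S i)"
      unfolding S_def by (rule sum_consecutive_blocks[symmetric]) (simp add: e_def div_le_mono)
    finally have "norm (\<Sum>k = 1..N n. cis (\<rho> n * g (xs n) (real k / real (N n)))) \<le> (\<Sum>i<Q. norm (S i))"
      by (simp add: norm_sum)
    also have "\<dots> = (\<Sum>i\<in>{..<Q} - bad. norm (S i)) + (\<Sum>i\<in>bad. norm (S i))"
      using bad(2) by (intro sum.subset_diff) auto
    also have "\<dots> \<le> (\<Sum>i\<in>{..<Q} - bad. \<epsilon> / (2 * real Q) * real (N n)) + (\<Sum>i\<in>bad. real (N n) / real Q + 1)"
      by (intro add_mono sum_mono good_i bad_i)
    also have "\<dots> \<le> real Q * (\<epsilon> / (2 * real Q) * real (N n)) + 2 * real (card Z) * (real (N n) / real Q + 1)"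
    proof (rule add_mono)
      have "card ({..<Q} - bad) \<le> Q" using card_mono[of "{..<Q}" "{..<Q} - bad"] by simp
      then have "real (card ({..<Q} - bad)) * (\<epsilon> / (2 * real Q) * real (N n)) \<le> real Q * (\<epsilon> / (2 * real Q) * real (N n))"
        using \<epsilon> by (intro mult_right_mono) auto
      then show "(\<Sum>i\<in>{..<Q} - bad. \<epsilon> / (2 * real Q) * real (N n)) \<le> real Q * (\<epsilon> / (2 * real Q) * real (N n))" by simp
      have "real (card bad) \<le> 2 * real (card Z)" using bad(1) by linarith
      then have "real (card bad) * (real (N n) / real Q + 1) \<le> 2 * real (card Z) * (real (N n) / real Q + 1)"
        by (intro mult_right_mono) auto
      then show "(\<Sum>i\<in>bad. real (N n) / real Q + 1) \<le> 2 * real (card Z) * (real (N n) / real Q + 1)" by simp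
    qed
    also have "\<dots> = \<epsilon> / 2 * real (N n) + (2 * real (card Z) / real Q) * real (N n) + 2 * real (card Z)"
      using \<open>Q > 0\<close> by (simp add: field_simps)
    also have "\<dots> \<le> \<epsilon> / 2 * real (N n) + \<epsilon> / 4 * real (N n) + \<epsilon> / 4 * real (N n)"
      by (intro add_mono mult_right_mono ZQ mN) auto
    also have "\<dots> = \<epsilon> * real (N n)" by simp
    finally show ?case .
  qed
qed

end

lemma rnd_order_gt_imp_nonzero_derivative:
  assumes "enat m < rnd_order \<gamma>" "int_vec h" "h \<noteq> 0"
  shows "\<exists>j>m. \<exists>t\<in>{0..1}. h \<bullet> curve_deriv j \<gamma> t \<noteq> 0"
proof -
  \<comment> \<open>The order is a supremum, so exceeding \<open>m\<close> only provides some
    admissible \<open>j > m\<close>, possibly different from \<open>m + 1\<close>.\<close>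
  obtain j where "enat m < enat j" "\<forall>h. int_vec h \<and> h \<noteq> 0 \<longrightarrow> \<not> (\<forall>t\<in>{0..1}. h \<bullet> curve_deriv j \<gamma> t = 0)"
    using assms(1) unfolding rnd_order_def less_Sup_iff by blast
  then show ?thesis using assms(2,3) by auto
qed

lemma exp_sums_tendsto_0:
  fixes \<phi> :: "real ^ 'm \<Rightarrow> real \<Rightarrow> real ^ 'd" and h :: "real ^ 'd"
  assumes U: "open U" "unit_cube \<times> {0..1} \<subseteq> U" and analytic: "real_analytic_family_on \<phi> U"
    and K: "K \<ge> 1" and order: "\<And>x. x \<in> unit_cube \<Longrightarrow> enat (K - 1) < rnd_order (\<phi> x)"
    and \<rho>_lim: "filterlim \<rho> at_top sequentially" and \<rho>_small: "\<rho> \<in> o(\<lambda>n. real n ^ K)"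
    and xs: "\<And>n. n \<ge> 1 \<Longrightarrow> xs n \<in> unit_cube"
    and h: "int_vec h" "h \<noteq> 0"
  shows "(\<lambda>n. (1 / of_nat n) * (\<Sum>k = 1..n. cis (2 * pi * (h \<bullet> (\<rho> n *\<^sub>R \<phi> (xs n) (real k / real n)))))) \<longlonglongrightarrow> 0"
    (is "?A \<longlonglongrightarrow> 0")
proof (rule ccontr)
  assume "\<not> ?thesis"
  then obtain \<epsilon> where \<epsilon>: "\<epsilon> > 0" and "\<not> (\<forall>\<^sub>F n in sequentially. norm (?A n) < \<epsilon>)"
    unfolding tendsto_iff dist_norm by auto
  then obtain r :: "nat \<Rightarrow> nat" where r: "strict_mono r" "\<And>n. \<not> norm (?A (r n)) < \<epsilon>"
    using not_eventually_sequentiallyD by blast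
  \<comment> \<open>The points \<open>xs n\<close> are known to lie in the cube only for n at least
    1, so the subsequence is started at \<open>Suc n\<close>.\<close>
  have r1: "r (Suc n) \<ge> 1" for n using seq_suble[OF r(1), of "Suc n"] by simp
  have "\<forall>n. xs (r (Suc n)) \<in> unit_cube" using xs r1 by blast
  then obtain x0 s where x0: "x0 \<in> unit_cube" and s: "strict_mono (s :: nat \<Rightarrow> nat)"
    and lim: "(\<lambda>n. xs (r (Suc (s n)))) \<longlonglongrightarrow> x0"
    using compact_unit_cube[where 'm = 'm] unfolding compact_def o_def by meson
  define N where "N n = r (Suc (s n))" for n
  have N: "strict_mono N" "\<And>n. N n \<ge> 1" and bigN: "\<And>n. \<not> norm (?A (N n)) < \<epsilon>"
    using r s r1 by (auto simp: N_def strict_mono_def)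
  have N_lim: "filterlim N at_top sequentially" using N(1) by (rule filterlim_subseq)
  define g where "g x t = h \<bullet> \<phi> x t" for x t
  have powser: "locally_powser g x t" if "(x, t) \<in> U" for x t
    unfolding g_def by (rule real_analytic_family_imp_locally_powser[OF analytic that])
  have "((\<lambda>n. 2 * pi * (\<rho> n / real n ^ K)) \<longlongrightarrow> 2 * pi * 0) sequentially"
    by (intro tendsto_mult_left smalloD_tendsto \<rho>_small)
  then have "((\<lambda>n. 2 * pi * (\<rho> (N n) / real (N n) ^ K)) \<longlongrightarrow> 2 * pi * 0) sequentially"
    by (rule filterlim_compose[OF _ N_lim])
  then have small: "((\<lambda>n. 2 * pi * \<rho> (N n) / real (N n) ^ K) \<longlongrightarrow> 0) sequentially" by simp
  have large: "filterlim (\<lambda>n. 2 * pi * \<rho> (N n)) at_top sequentially"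
    by (intro filterlim_tendsto_pos_mult_at_top[OF tendsto_const] filterlim_compose[OF \<rho>_lim N_lim]) simp
  \<comment> \<open>The factor 2 pi of the character is absorbed into the amplitude.\<close>
  interpret analytic_phase g unit_cube K x0 sequentially "\<lambda>n. xs (N n)" N "\<lambda>n. 2 * pi * \<rho> (N n)"
  proof
    show "locally_powser g x t" if "x \<in> unit_cube" "t \<in> {0..1}" for x t
      using powser U that by blast
    show "(\<lambda>n. xs (N n)) \<longlonglongrightarrow> x0" using lim by (simp add: N_def)
  qed (use compact_unit_cube x0 K xs N N_lim small large in auto)
  obtain j t where j: "j > K - 1" and t: "t \<in> {0..1}" and nz: "h \<bullet> curve_deriv j (\<phi> x0) t \<noteq> 0"
    using rnd_order_gt_imp_nonzero_derivative[OF order[OF x0] h] by blast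
  have "h \<bullet> curve_deriv j (\<phi> x0) t = (deriv ^^ j) (\<lambda>s. h \<bullet> \<phi> x0 s) t"
  proof (rule inner_curve_deriv)
    \<comment> \<open>The t-slice of \<open>U\<close> is an open set containing [0, 1], which makes
      derivatives at the endpoints two-sided.\<close>
    show "open {t. (x0, t) \<in> U}"
      using open_vimage[OF U(1), of "\<lambda>t. (x0, t)"] by (simp add: vimage_def continuous_on_Pair)
    show "t \<in> {t. (x0, t) \<in> U}" using U x0 t by auto
    show "((deriv ^^ j) (\<lambda>s. \<phi> x0 s $ i) has_real_derivative (deriv ^^ Suc j) (\<lambda>s. \<phi> x0 s $ i) t) (at t)"
      if "t \<in> {t. (x0, t) \<in> U}" for j i t
    proof -
      have "locally_powser (\<lambda>x t. axis i 1 \<bullet> \<phi> x t) x0 t"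
        using that by (intro real_analytic_family_imp_locally_powser[OF analytic]) simp
      from locally_powser_imp_has_deriv[OF locally_powser_funpow_deriv[OF this]]
      show ?thesis by (simp add: inner_axis')
    qed
  qed
  then have "\<exists>t\<in>{0..1}. (deriv ^^ j) (g x0) t \<noteq> 0"
    using nz t by (auto simp: g_def[abs_def])
  then have fin: "finite {t \<in> {0..1}. (deriv ^^ i) (g x0) t = 0}" if "i \<in> {1..K}" for i
    using that j x0 U by (intro finite_zeros_lower_derivative[where j = j] powser) auto
  have "\<forall>\<^sub>F n in sequentially. norm (\<Sum>k = 1..N n. cis (2 * pi * \<rho> (N n) * g (xs (N n)) (real k / real (N n)))) \<le> \<epsilon> / 2 * real (N n)"
    using \<epsilon> by (intro exp_sum_eventually_small fin) auto
  then obtain n where n: "norm (\<Sum>k = 1..N n. cis (2 * pi * \<rho> (N n) * g (xs (N n)) (real k / real (N n)))) \<le> \<epsilon> / 2 * real (N n)"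
    by (metis (mono_tags, lifting) eventually_sequentially order_refl)
  have "norm (?A (N n)) = norm (\<Sum>k = 1..N n. cis (2 * pi * \<rho> (N n) * g (xs (N n)) (real k / real (N n)))) / real (N n)"
    by (simp add: norm_mult norm_divide g_def mult.assoc)
  also have "\<dots> \<le> \<epsilon> / 2" using n N(2)[of n] by (simp add: field_simps)
  also have "\<dots> < \<epsilon>" using \<epsilon> by simp
  finally show False using bigN by blast
qed

theorem theorem1p2:
  fixes \<phi> :: "real ^ 'm \<Rightarrow> real \<Rightarrow> real ^ 'd"
    and \<kappa> :: enat
    and \<rho> :: "nat \<Rightarrow> real"
    and xs :: "nat \<Rightarrow> real ^ 'm"
  assumes analytic: "\<exists>U. open U \<and> unit_cube \<times> {0..1} \<subseteq> U \<and> real_analytic_family_on \<phi> U"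
    and order: "rnd_order_family \<phi> = \<kappa>"
    and kappa_ge: "2 \<le> \<kappa>"
    and rho_lim: "filterlim \<rho> at_top sequentially"
    and growth_fin: "\<And>k::nat. \<kappa> = enat k \<Longrightarrow> \<rho> \<in> o(\<lambda>n. real n ^ k)"
    and growth_inf: "\<kappa> = \<infinity> \<Longrightarrow> (\<exists>l::nat. \<rho> \<in> o(\<lambda>n. real n ^ l))"
    and xs_cube: "\<And>n. n \<ge> 1 \<Longrightarrow> xs n \<in> unit_cube"
  shows "\<forall>f :: real ^ 'd \<Rightarrow> real.
           continuous_on UNIV f \<and> (\<forall>x h. int_vec h \<longrightarrow> f (x + h) = f x) \<longrightarrow>
           (\<lambda>n. (1 / real n) * (\<Sum>k = 1..n. f (\<rho> n *\<^sub>R \<phi> (xs n) (real k / real n))))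
             \<longlonglongrightarrow> integral unit_cube f"
proof -
  \<comment> \<open>The condition \<open>enat (K - 1) < \<kappa>\<close> gives nonvanishing
    derivatives of order at least \<open>K\<close>, matching the growth exponent; for finite
    \<kappa> it permits \<open>K\<close> equal to \<kappa> itself.\<close>
  obtain K where K: "K \<ge> 1" "enat (K - 1) < \<kappa>" "\<rho> \<in> o(\<lambda>n. real n ^ K)"
  proof (cases \<kappa>)
    case (enat k)
    have "k \<ge> 2" using kappa_ge enat by (simp add: numeral_eq_enat)
    then show thesis using that[of k] growth_fin[OF enat] enat by simp
  next
    case infinity
    then obtain l where l: "\<rho> \<in> o(\<lambda>n. real n ^ l)" using growth_inf by blast
    \<comment> \<open>For infinite order the exponent is raised to \<open>Suc l\<close>, so that
      \<open>K\<close> is at least 1 whatever \<open>l\<close> is.\<close>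
    have "(\<lambda>n. real n ^ l) \<in> O(\<lambda>n. real n ^ Suc l)"
    proof (rule bigoI[where c = 1])
      show "\<forall>\<^sub>F n in sequentially. norm (real n ^ l) \<le> 1 * norm (real n ^ Suc l)"
        using eventually_ge_at_top[of 1] by eventually_elim (simp add: mult_le_cancel_right1)
    qed
    then have "\<rho> \<in> o(\<lambda>n. real n ^ Suc l)" by (rule landau_o.small_big_trans[OF l])
    then show thesis using that[of "Suc l"] infinity by simp
  qed
  have rnd: "enat (K - 1) < rnd_order (\<phi> x)" if "x \<in> unit_cube" for x
    using K(2) INF_lower[OF that, of "\<lambda>x. rnd_order (\<phi> x)"] order
    unfolding rnd_order_family_def by (metis order_less_le_trans)
  obtain U where U: "open U" "unit_cube \<times> {0..1} \<subseteq> U" "real_analytic_family_on \<phi> U"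
    using analytic by blast
  show ?thesis
  proof (intro allI impI, elim conjE)
    fix f :: "real ^ 'd \<Rightarrow> real"
    assume "continuous_on UNIV f" "\<forall>x h. int_vec h \<longrightarrow> f (x + h) = f x"
    then show "(\<lambda>n. (1 / real n) * (\<Sum>k = 1..n. f (\<rho> n *\<^sub>R \<phi> (xs n) (real k / real n))))
        \<longlonglongrightarrow> integral unit_cube f"
      by (intro Weyl_criterion exp_sums_tendsto_0[OF U K(1) rnd rho_lim K(3) xs_cube]) auto
  qed
qed

end
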